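(* Let $0<\theta<1$, let $A:\mathbb{R}^2\to\mathbb{R}^2$ be $$A(\eta)=\begin{pmatrix}1+\sqrt{\theta}\sin(\pi\eta_1)&0\\0&1+\sqrt{\theta}\sin(\pi\eta_2)\end{pmatrix}\begin{pmatrix}\eta_1\\\eta_2\end{pmatrix},\qquad \eta=(\eta_1,\eta_2)\in\mathbb{R}^2,$$ and let $$\bar q=\sup_{L\in\{2,4,6,\dots\}}\left(1-\frac{1}{1+L}+\frac{1}{1+L(1-\theta)}\right).$$ Then for any $\Lambda>0$ and any $r\in(1,\bar q)$ there exist a Lipschitz map $u\in W^{1,\infty}_0(\mathbb{B}^2)$ and $F\in L^\infty(\mathbb{B}^2,\mathbb{R}^2)$ such that $$\begin{cases}\operatorname{div}(A(\nabla u))=\operatorname{div}F&\text{in }\mathbb{B}^2,\\ u=0&\text{on }\partial\mathbb{B}^2,\end{cases}$$ but $$\int_{\mathbb{B}^2}|\nabla u|^r>\Lambda\left(1+\int_{\mathbb{B}^2}|F|^r\right).$$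
   Context: $\mathbb{B}^2$ is the open unit ball of $\mathbb{R}^2$. The function $u$ is real-valued, and the equation is understood in the sense of distributions. *)

theory Defs
  imports "HOL-Analysis.Analysis"
begin

definition grad :: "('a::euclidean_space \<Rightarrow> real) \<Rightarrow> 'a \<Rightarrow> 'a" where
  "grad f x = (\<Sum>b\<in>Basis. frechet_derivative f (at x) b *\<^sub>R b)"

primrec C_k :: "nat \<Rightarrow> ('a::euclidean_space \<Rightarrow> real) \<Rightarrow> bool" where
  "C_k 0 f \<longleftrightarrow> continuous_on UNIV f"
| "C_k (Suc k) f \<longleftrightarrow> (\<forall>x. f differentiable at x) \<and>
     (\<forall>b\<in>Basis. C_k k (\<lambda>x. frechet_derivative f (at x) b))"

text \<open>Elements of \<open>C\<^sub>c\<^sup>\<infinity>(\<Omega>)\<close> are represented by their extension by zero to the whole space.\<close>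

definition test_functions :: "'a::euclidean_space set \<Rightarrow> ('a \<Rightarrow> real) set" where
  "test_functions \<Omega> = {\<phi>. (\<forall>k. C_k k \<phi>) \<and>
     compact (closure {x. \<phi> x \<noteq> 0}) \<and> closure {x. \<phi> x \<noteq> 0} \<subseteq> \<Omega>}"

definition locally_integrable ::
    "'a::euclidean_space set \<Rightarrow> ('a \<Rightarrow> 'b::euclidean_space) \<Rightarrow> bool" where
  "locally_integrable \<Omega> f \<longleftrightarrow>
     (\<forall>K. compact K \<and> K \<subseteq> \<Omega> \<longrightarrow> f absolutely_integrable_on K)"

text \<open>The weak gradient is a relation, since it is determined only almost everywhere.\<close>

definition has_weak_gradient ::
    "'a::euclidean_space set \<Rightarrow> ('a \<Rightarrow> real) \<Rightarrow> ('a \<Rightarrow> 'a) \<Rightarrow> bool" where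
  "has_weak_gradient \<Omega> u G \<longleftrightarrow>
     locally_integrable \<Omega> u \<and> locally_integrable \<Omega> G \<and>
     (\<forall>\<phi>\<in>test_functions \<Omega>.
        (LINT x|lebesgue_on \<Omega>. u x *\<^sub>R grad \<phi> x) = - (LINT x|lebesgue_on \<Omega>. \<phi> x *\<^sub>R G x))"

definition L_infty :: "'a::euclidean_space set \<Rightarrow> ('a \<Rightarrow> 'b::euclidean_space) set" where
  "L_infty \<Omega> = {f \<in> borel_measurable (lebesgue_on \<Omega>).
     \<exists>M. AE x in lebesgue_on \<Omega>. norm (f x) \<le> M}"

definition W1_infty :: "'a::euclidean_space set \<Rightarrow> ('a \<Rightarrow> real) set" where
  "W1_infty \<Omega> = {u \<in> L_infty \<Omega>. \<exists>G \<in> L_infty \<Omega>. has_weak_gradient \<Omega> u G}"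

text \<open>The closure of \<open>C\<^sub>c\<^sup>\<infinity>(\<Omega>)\<close> in the \<open>W\<^sup>1\<^sup>,\<^sup>1(\<Omega>)\<close> norm.\<close>

definition W1_1_0 :: "'a::euclidean_space set \<Rightarrow> ('a \<Rightarrow> real) set" where
  "W1_1_0 \<Omega> = {u. integrable (lebesgue_on \<Omega>) u \<and>
     (\<exists>G. integrable (lebesgue_on \<Omega>) G \<and> has_weak_gradient \<Omega> u G \<and>
       (\<exists>\<phi>. (\<forall>n::nat. \<phi> n \<in> test_functions \<Omega>) \<and>
         (\<lambda>n. (LINT x|lebesgue_on \<Omega>. \<bar>u x - \<phi> n x\<bar>) +
               (LINT x|lebesgue_on \<Omega>. norm (G x - grad (\<phi> n) x))) \<longlonglongrightarrow> 0))}"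

text \<open>The usual convention for exponent \<open>\<infinity>\<close>: the closure of the test functions in the
  \<open>W\<^sup>1\<^sup>,\<^sup>\<infinity>\<close> norm would contain only \<open>C\<^sup>1\<close> functions.\<close>

definition W1_infty_0 :: "'a::euclidean_space set \<Rightarrow> ('a \<Rightarrow> real) set" where
  "W1_infty_0 \<Omega> = W1_infty \<Omega> \<inter> W1_1_0 \<Omega>"

text \<open>The divergence of a locally integrable vector field, as a distribution.\<close>

definition distr_div ::
    "'a::euclidean_space set \<Rightarrow> ('a \<Rightarrow> 'a) \<Rightarrow> ('a \<Rightarrow> real) \<Rightarrow> real" where
  "distr_div \<Omega> V \<phi> = - (LINT x|lebesgue_on \<Omega>. V x \<bullet> grad \<phi> x)"

definition A_field :: "real \<Rightarrow> real^2 \<Rightarrow> real^2" where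
  "A_field \<theta> \<eta> =
     (vector [vector [1 + sqrt \<theta> * sin (pi * \<eta> $ 1), 0],
              vector [0, 1 + sqrt \<theta> * sin (pi * \<eta> $ 2)]] :: real^2^2) *v \<eta>"

definition q_bar :: "real \<Rightarrow> real" where
  "q_bar \<theta> = (SUP L \<in> {L::nat. even L \<and> L \<ge> 2}.
     1 - 1 / (1 + real L) + 1 / (1 + real L * (1 - \<theta>)))"

end

(*
  For Lipschitz u and v, the field F = A(grad u) - (d2 v, -d1 v) has the same divergence as
  A(grad u), so it suffices to make F small in L^r compared with grad u. Up to small off-diagonal
  entries, the pair (a, b) = (d1 u, d2 v) follows a staircase laminate in the plane, in which
  every splitting is horizontal (u oscillates in x1) or vertical (v oscillates in x2).
  The points (x, -m x) and (-x, m x) with m = L (1 - theta) are split horizontally towards the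
  line b = a, which carries exact solutions when a is an integer, and then vertically towards
  b = (1 - theta) a, exact when sin(pi a) = -sqrt theta. Going from x to x + 2 keeps a
  fraction 1 - (2 / x) (1 / (1 + m) + L / (1 + L)) + o(1 / x) of the mass. Hence the unresolved
  mass at height x decays like x^(-p) with p = L / (1 + L) + 1 / (1 + m), which exceeds r for
  some L, and its contribution to the integral of |F|^r vanishes in the limit. The resolved
  points carry defects bounded by 1, negligible once the staircase starts high enough.
  Realising each finite laminate by smooth compactly supported functions makes membership in
  the Sobolev spaces immediate.
*)

theory Submission
  imports Defs "HOL-Real_Asymp.Real_Asymp"
begin

section \<open>Smooth functions\<close>

text \<open>It suffices to make one scalar mean very negative: that of \<open>defect_cost\<close>
  over perturbations around the origin. It sees only the first component of F; the second is built
  from off-diagonal derivatives and stays bounded by 3. Laminates are never formed as measures: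
  \<open>achievable g X t\<close> keeps only an upper bound for the mean, and such bounds may be
  averaged along both coordinate axes. The obstacle is that localising a split by a cut-off creates
  an uncontrolled transversal derivative. It can be removed because u and v have separate
  amplitudes: a box may be squeezed in one direction without changing the pair (a, b), while
  transversal derivatives are multiplied by ratios of sides. The large gradient need not accumulate
  along the steps. The first horizontal split, from the axis a = 0, already puts a fixed share of
  the mass at distance about m x, while the whole rest of the staircase costs at most 1. Zero
  boundary values force barycentre 0, hence two staircases, starting from (0, -Y) and (0, Z). As
  \<open>flux\<close> is not odd, they are not mirror images, and the sign \<sigma> shifts the
  heights.\<close>

definition pd :: "'a \<Rightarrow> ('a::euclidean_space \<Rightarrow> real) \<Rightarrow> 'a \<Rightarrow> real" where
  "pd b f x = frechet_derivative f (at x) b"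

lemma C_k_Suc_iff:
  "C_k (Suc k) f \<longleftrightarrow> (\<forall>x. f differentiable at x) \<and> (\<forall>b\<in>Basis. C_k k (pd b f))"
  by (simp add: pd_def[abs_def])

lemma pd_eqI: "(f has_derivative f') (at x) \<Longrightarrow> pd b f x = f' b"
  unfolding pd_def by (metis frechet_derivative_at)

lemma C_k_imp_continuous_on: "C_k k f \<Longrightarrow> continuous_on UNIV f"
  by (cases k) (auto simp: continuous_at_imp_continuous_on differentiable_imp_continuous_within)

lemma C_k_SucD: "C_k (Suc k) f \<Longrightarrow> C_k k f"
proof (induction k arbitrary: f)
  case 0
  then show ?case using C_k_imp_continuous_on C_k.simps(1) by blast
next
  case (Suc k)
  then show ?case unfolding C_k_Suc_iff[of "Suc k"] C_k_Suc_iff[of k f] by blast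
qed

lemma C_k_const: "C_k k (\<lambda>x::'a::euclidean_space. c)"
proof (induction k arbitrary: c)
  case 0 then show ?case by simp
next
  case (Suc k)
  have "pd b (\<lambda>x::'a. c) = (\<lambda>x. 0)" for b
    by (rule ext, rule pd_eqI) auto
  then show ?case unfolding C_k_Suc_iff using Suc by auto
qed

lemma pd_add: "f differentiable at x \<Longrightarrow> g differentiable at x \<Longrightarrow>
    pd b (\<lambda>x. f x + g x) x = pd b f x + pd b g x"
  unfolding pd_def by (subst frechet_derivative_at[symmetric])
    (auto intro!: derivative_eq_intros simp: frechet_derivative_works[symmetric])

lemma pd_mult: "f differentiable at x \<Longrightarrow> g differentiable at x \<Longrightarrow>
    pd b (\<lambda>x. f x * g x) x = f x * pd b g x + pd b f x * g x"
  by (rule pd_eqI) (auto simp: pd_def intro!: derivative_eq_intros simp: frechet_derivative_works[symmetric])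

lemma C_k_add: "C_k k f \<Longrightarrow> C_k k g \<Longrightarrow> C_k k (\<lambda>x. f x + g x)"
proof (induction k arbitrary: f g)
  case 0 then show ?case by (auto intro: continuous_intros)
next
  case (Suc k)
  have "pd b (\<lambda>x. f x + g x) = (\<lambda>x. pd b f x + pd b g x)" for b
    using Suc.prems unfolding C_k_Suc_iff by (intro ext pd_add) auto
  then show ?case using Suc unfolding C_k_Suc_iff by auto
qed

lemma C_k_mult: "C_k k f \<Longrightarrow> C_k k g \<Longrightarrow> C_k k (\<lambda>x. f x * g x)"
proof (induction k arbitrary: f g)
  case 0 then show ?case by (auto intro: continuous_intros)
next
  case (Suc k)
  have "pd b (\<lambda>x. f x * g x) = (\<lambda>x. f x * pd b g x + pd b f x * g x)" for b
    using Suc.prems unfolding C_k_Suc_iff by (intro ext pd_mult) auto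
  then show ?case using Suc C_k_SucD[OF Suc.prems(1)] C_k_SucD[OF Suc.prems(2)]
    unfolding C_k_Suc_iff by (auto intro!: C_k_add)
qed

lemma C_k_sum: "(\<And>i. i \<in> I \<Longrightarrow> C_k k (f i)) \<Longrightarrow> C_k k (\<lambda>x. \<Sum>i\<in>I. f i x)"
  by (induction I rule: infinite_finite_induct) (auto intro: C_k_const C_k_add)

lemma pd_compose_affine:
  fixes f :: "'b::euclidean_space \<Rightarrow> real" and L :: "'a::euclidean_space \<Rightarrow> 'b"
  assumes "bounded_linear L" "f differentiable at (L x + c)"
  shows "pd b (\<lambda>x. f (L x + c)) x = frechet_derivative f (at (L x + c)) (L b)"
    and "(\<lambda>x. f (L x + c)) differentiable at x"
proof -
  have 1: "((\<lambda>x. L x + c) has_derivative L) (at x)"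
    by (auto intro!: derivative_eq_intros bounded_linear_imp_has_derivative assms)
  have 2: "(f has_derivative frechet_derivative f (at (L x + c))) (at (L x + c))"
    using assms frechet_derivative_works by blast
  have "((\<lambda>x. f (L x + c)) has_derivative (\<lambda>h. frechet_derivative f (at (L x + c)) (L h))) (at x)"
    using has_derivative_compose[OF 1 2] .
  then show "pd b (\<lambda>x. f (L x + c)) x = frechet_derivative f (at (L x + c)) (L b)"
     "(\<lambda>x. f (L x + c)) differentiable at x"
    using pd_eqI differentiable_def by blast+
qed

lemma frechet_derivative_eq_sum_pd:
  assumes "f differentiable at x"
  shows "frechet_derivative f (at x) v = (\<Sum>b\<in>Basis. (v \<bullet> b) * pd b f x)"
proof -
  interpret linear "frechet_derivative f (at x)" using assms linear_frechet_derivative by blast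
  have "frechet_derivative f (at x) v = frechet_derivative f (at x) (\<Sum>b\<in>Basis. (v \<bullet> b) *\<^sub>R b)"
    by (simp add: euclidean_representation)
  then show ?thesis by (simp add: sum scale pd_def)
qed

lemma C_k_compose_affine:
  fixes f :: "'b::euclidean_space \<Rightarrow> real" and L :: "'a::euclidean_space \<Rightarrow> 'b"
  assumes L: "bounded_linear L"
  shows "C_k k f \<Longrightarrow> C_k k (\<lambda>x. f (L x + c))"
proof (induction k arbitrary: f)
  case 0
  have "continuous_on UNIV (\<lambda>x. L x + c)"
    by (intro continuous_intros linear_continuous_on L)
  then show ?case using 0 by (auto intro: continuous_on_compose2)
next
  case (Suc k)
  then have d: "f differentiable at y" for y unfolding C_k_Suc_iff by blast
  have "pd b (\<lambda>x. f (L x + c)) = (\<lambda>x. \<Sum>b'\<in>Basis. (L b \<bullet> b') * pd b' f (L x + c))" for b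
    by (rule ext) (simp add: pd_compose_affine[OF L d] frechet_derivative_eq_sum_pd[OF d])
  then show ?case using Suc d pd_compose_affine(2)[OF L d] unfolding C_k_Suc_iff
    by (auto intro!: C_k_sum C_k_mult C_k_const)
qed

section \<open>Smooth functions of one variable: flat functions, bumps and ramps\<close>

lemma C_k_real_Suc:
  fixes f :: "real \<Rightarrow> real"
  assumes "\<And>x. (f has_real_derivative f' x) (at x)"
  shows "C_k (Suc k) f \<longleftrightarrow> C_k k f'"
proof -
  have "pd 1 f = f'"
    using assms by (intro ext) (auto intro!: pd_eqI[THEN trans] simp: has_field_derivative_def)
  then show ?thesis
    unfolding C_k_Suc_iff using assms real_differentiable_def by auto
qed

text \<open>Allowing every polynomial in 1/x in front of exp (-1/x) gives a class closed under
  differentiation, so that smoothness at 0 becomes an induction. \<open>exp_cut 1\<close> is the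
  classical flat function.\<close>

definition exp_cut :: "real poly \<Rightarrow> real \<Rightarrow> real" where
  "exp_cut p x = (if x > 0 then poly p (1 / x) * exp (- (1 / x)) else 0)"

lemma poly_exp_tendsto_0: "((\<lambda>x. poly p x * exp (- x)) \<longlongrightarrow> (0::real)) at_top"
proof -
  have "((\<lambda>x. (\<Sum>i\<le>degree p. coeff p i * (x ^ i / exp x))) \<longlongrightarrow>
     (\<Sum>i\<le>degree p. coeff p i * 0)) at_top"
    by (intro tendsto_sum tendsto_mult tendsto_const tendsto_power_div_exp_0)
  moreover have "(\<Sum>i\<le>degree p. coeff p i * (x ^ i / exp x)) = poly p x * exp (- x)" for x
    by (simp add: poly_altdef sum_distrib_right exp_minus divide_inverse mult.assoc)
  ultimately show ?thesis by simp
qed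

lemma exp_cut_has_derivative:
  "(exp_cut p has_real_derivative exp_cut (monom 1 2 * (p - pderiv p)) x) (at x)"
proof -
  consider "x > 0" | "x < 0" | "x = 0" by linarith
  then show ?thesis
  proof cases
    case 1
    have "((\<lambda>x. poly p (1 / x) * exp (- (1 / x))) has_real_derivative
        exp_cut (monom 1 2 * (p - pderiv p)) x) (at x)"
      using 1 unfolding exp_cut_def
      by (auto intro!: derivative_eq_intros DERIV_chain'[OF _ poly_DERIV]
          simp: poly_monom field_simps power2_eq_square)
    then show ?thesis
      by (rule has_field_derivative_transform_within_open[of _ _ _ "{0<..}"])
        (use 1 in \<open>auto simp: exp_cut_def\<close>)
  next
    case 2
    have "((\<lambda>x. 0) has_real_derivative exp_cut (monom 1 2 * (p - pderiv p)) x) (at x)"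
      using 2 by (simp add: exp_cut_def)
    then show ?thesis
      by (rule has_field_derivative_transform_within_open[of _ _ _ "{..<0}"])
        (use 2 in \<open>auto simp: exp_cut_def\<close>)
  next
    case 3
    \<comment> \<open>The factor 1/h of the difference quotient at 0 is absorbed into the polynomial
      as \<open>pCons 0 p\<close>.\<close>
    have "((\<lambda>y. poly (pCons 0 p) y * exp (-y)) \<longlongrightarrow> 0) at_top" by (rule poly_exp_tendsto_0)
    then have "((\<lambda>h. poly (pCons 0 p) (inverse h) * exp (- inverse h)) \<longlongrightarrow> 0) (at_right 0)"
      using filterlim_compose filterlim_inverse_at_top_right by blast
    then have r: "((\<lambda>h. exp_cut p h / h) \<longlongrightarrow> 0) (at_right 0)"
      by (rule Lim_transform_eventually)
        (auto simp: eventually_at_filter exp_cut_def field_simps intro!: always_eventually)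
    have l: "((\<lambda>h. exp_cut p h / h) \<longlongrightarrow> 0) (at_left 0)"
      by (rule Lim_transform_eventually[of "\<lambda>_. 0"])
        (auto simp: eventually_at_filter exp_cut_def field_simps intro!: always_eventually)
    have "((\<lambda>h. exp_cut p h / h) \<longlongrightarrow> 0) (at 0)"
      using l r filterlim_split_at by blast
    then show ?thesis using 3 by (simp add: DERIV_def exp_cut_def)
  qed
qed

lemma C_k_exp_cut: "C_k k (exp_cut p)"
proof (induction k arbitrary: p)
  case 0
  then show ?case using exp_cut_has_derivative
    by (metis C_k.simps(1) DERIV_isCont continuous_at_imp_continuous_on)
next
  case (Suc k)
  then show ?case using C_k_real_Suc[OF exp_cut_has_derivative] by blast
qed

lemma smooth_antiderivative:
  fixes f :: "real \<Rightarrow> real"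
  assumes "\<And>k. C_k k f"
  obtains F where "\<And>x. (F has_real_derivative f x) (at x)" "\<And>k. C_k k F" "F 0 = 0"
proof -
  have c: "isCont f x" for x
    using C_k_imp_continuous_on[OF assms] by (simp add: continuous_on_eq_continuous_at)
  have "\<exists>F. \<forall>x::real. -\<infinity> < ereal x \<longrightarrow> ereal x < \<infinity> \<longrightarrow> (F has_vector_derivative f x) (at x)"
    by (rule einterval_antiderivative) (auto intro: c)
  then obtain F where F: "\<And>x. (F has_real_derivative f x) (at x)"
    by (auto simp: has_real_derivative_iff_has_vector_derivative)
  have F': "((\<lambda>x. F x - F 0) has_real_derivative f x) (at x)" for x
    by (auto intro!: derivative_eq_intros F)
  have "C_k k (\<lambda>x. F x - F 0)" for k
  proof (cases k)
    case 0
    then show ?thesis using F' by (metis C_k.simps(1) DERIV_isCont continuous_at_imp_continuous_on)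
  next
    case (Suc k')
    then show ?thesis using C_k_real_Suc[OF F'] assms by blast
  qed
  then show thesis using that[OF F'] by simp
qed

lemma const_if_deriv_0:
  fixes f :: "real \<Rightarrow> real"
  assumes "\<And>x. (f has_real_derivative f' x) (at x)" "x < y"
    "\<And>t. x < t \<Longrightarrow> t < y \<Longrightarrow> f' t = 0"
  shows "f x = f y"
proof -
  have "f y = f x"
  proof (rule DERIV_isconst_end[OF assms(2)])
    show "continuous_on {x..y} f"
      using assms(1) DERIV_isCont continuous_at_imp_continuous_on by blast
    show "(f has_real_derivative 0) (at t)" if "x < t" "t < y" for t
      using assms(1)[of t] assms(3)[OF that] by simp
  qed
  then show ?thesis by simp
qed

text \<open>A normalised bump is integrated twice, so \<open>T\<close> is a corner from slope 0 to
  slope 1, rounded on [0, 1]. The constant \<open>c\<close> is the delay left by the rounding; it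
  cancels in \<open>split_base\<close>.\<close>

lemma smooth_ramp:
  obtains T S b :: "real \<Rightarrow> real" and c :: real where
    "\<And>x. (T has_real_derivative S x) (at x)" "\<And>x. (S has_real_derivative b x) (at x)"
    "\<And>k. C_k k T" "\<And>k. C_k k S" "\<And>k. C_k k b"
    "\<And>x. x \<le> 0 \<Longrightarrow> T x = 0" "\<And>x. 1 \<le> x \<Longrightarrow> T x = x - c"
    "\<And>x. x \<le> 0 \<Longrightarrow> S x = 0" "\<And>x. 1 \<le> x \<Longrightarrow> S x = 1" "mono S"
proof -
  define b0 where "b0 x = exp_cut 1 x * exp_cut 1 (1 - x)" for x
  have C0: "C_k k b0" for k unfolding b0_def
    using C_k_compose_affine[of uminus k "exp_cut 1" "1::real"]
    by (intro C_k_mult C_k_exp_cut) (auto simp: C_k_exp_cut bounded_linear_minus)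
  have b0_pos: "b0 x \<ge> 0" for x by (auto simp: b0_def exp_cut_def)
  have b0_0: "b0 x = 0" if "x \<le> 0 \<or> x \<ge> 1" for x using that by (auto simp: b0_def exp_cut_def)
  obtain S0 where S0: "\<And>x. (S0 has_real_derivative b0 x) (at x)" "\<And>k. C_k k S0" "S0 0 = 0"
    using smooth_antiderivative[OF C0] by blast
  have mono0: "S0 x \<le> S0 y" if "x \<le> y" for x y
    by (rule DERIV_nonneg_imp_nondecreasing[OF that]) (use S0 b0_pos in auto)
  have const: "S0 x = S0 y" if "x < y" "y \<le> 0 \<or> 1 \<le> x" for x y
    using that b0_0 by (intro const_if_deriv_0[OF S0(1)]) auto
  \<comment> \<open>If the bump had no mass, the monotone \<open>S0\<close> would be constant on
    [0, 1], although its derivative at 1/2 is not zero.\<close>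
  have "S0 1 \<noteq> 0"
  proof
    assume "S0 1 = 0"
    then have z: "S0 x = 0" if "0 \<le> x" "x \<le> 1" for x
      using mono0[of 0 x] mono0[of x 1] S0(3) that by simp
    have "((\<lambda>x. 0) has_real_derivative b0 (1/2)) (at (1/2))"
      by (rule has_field_derivative_transform_within_open[OF S0(1), where S="{0<..<1}"]) (auto simp: z)
    then have "b0 (1/2) = 0" using DERIV_const DERIV_unique by blast
    then show False by (simp add: b0_def exp_cut_def)
  qed
  moreover have "S0 0 \<le> S0 1" by (rule mono0) simp
  ultimately have pos: "S0 1 > 0" using S0(3) by linarith
  define S where "S x = 1 / S0 1 * S0 x" for x
  define b where "b x = 1 / S0 1 * b0 x" for x
  have CS: "C_k k S" and Cb: "C_k k b" for k
    unfolding S_def b_def by (intro C_k_mult C_k_const S0 C0)+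
  have dS: "(S has_real_derivative b x) (at x)" for x unfolding S_def b_def
    using pos by (auto intro!: derivative_eq_intros S0)
  have Sz: "S x = 0" if "x \<le> 0" for x
    using const[of x 0] S0(3) that by (cases "x = 0") (auto simp: S_def)
  have So: "S x = 1" if "1 \<le> x" for x
    using const[of 1 x] pos that by (cases "x = 1") (auto simp: S_def)
  have mS: "mono S" unfolding S_def using mono0 pos by (auto simp: mono_def divide_right_mono)
  obtain T where T: "\<And>x. (T has_real_derivative S x) (at x)" "\<And>k. C_k k T" "T 0 = 0"
    using smooth_antiderivative[OF CS] by blast
  have T0: "T x = 0" if "x \<le> 0" for x
  proof (cases "x = 0")
    case False
    have "T x = T 0"
      using that Sz False by (intro const_if_deriv_0[OF T(1)]) auto
    then show ?thesis using T by simp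
  qed (use T in simp)
  have T1: "T x = x - (1 - T 1)" if "1 \<le> x" for x
  proof (cases "x = 1")
    case False
    have d: "((\<lambda>x. T x - x) has_real_derivative S x - 1) (at x)" for x
      by (auto intro!: derivative_eq_intros T)
    have "T 1 - 1 = T x - x"
      using that So False by (intro const_if_deriv_0[OF d]) auto
    then show ?thesis by simp
  qed simp
  show thesis by (rule that[OF T(1) dS T(2) CS Cb T0 T1 Sz So mS])
qed

definition smooth :: "('a::euclidean_space \<Rightarrow> real) \<Rightarrow> bool" where
  "smooth f \<longleftrightarrow> (\<forall>k. C_k k f)"

abbreviation D :: "'n \<Rightarrow> (real^'n::finite \<Rightarrow> real) \<Rightarrow> real^'n \<Rightarrow> real" where
  "D i \<equiv> pd (axis i 1)"

lemma smooth_const: "smooth (\<lambda>x. c)"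
  and smooth_add: "smooth f \<Longrightarrow> smooth g \<Longrightarrow> smooth (\<lambda>x. f x + g x)"
  and smooth_mult: "smooth f \<Longrightarrow> smooth g \<Longrightarrow> smooth (\<lambda>x. f x * g x)"
  by (simp_all add: smooth_def C_k_const C_k_add C_k_mult)

lemma smooth_compose_affine: "bounded_linear L \<Longrightarrow> smooth f \<Longrightarrow> smooth (\<lambda>x. f (L x + c))"
  by (simp add: smooth_def C_k_compose_affine)

lemma smooth_differentiable: "smooth f \<Longrightarrow> f differentiable at x"
  unfolding smooth_def using C_k_Suc_iff by blast

lemma smooth_pd: "smooth f \<Longrightarrow> b \<in> Basis \<Longrightarrow> smooth (pd b f)"
  unfolding smooth_def using C_k_Suc_iff by blast

lemma smooth_continuous_on: "smooth f \<Longrightarrow> continuous_on S f"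
  unfolding smooth_def by (meson C_k_imp_continuous_on continuous_on_subset subset_UNIV)

lemma smooth_D: "smooth f \<Longrightarrow> smooth (D i f)"
  by (rule smooth_pd) (auto simp: axis_in_Basis_iff)

text \<open>The boundary of the box is covered too: the derivative is continuous and vanishes off
  the closed box, and the closure of that set is the complement of the open box.\<close>

lemma pd_eq_0_outside:
  assumes "smooth f" "\<And>x. x \<notin> cbox a b \<Longrightarrow> f x = 0" "x \<notin> box a b" "v \<in> Basis"
  shows "pd v f x = 0"
proof -
  have "pd v f y = 0" if "y \<in> - cbox a b" for y
  proof -
    have "(f has_derivative (\<lambda>_. 0)) (at y)"
      by (rule has_derivative_transform_within_open[of "\<lambda>_. 0" _ _ _ "- cbox a b"])
        (use that assms(2) in \<open>auto simp: open_Compl closed_cbox\<close>)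
    then show ?thesis by (rule pd_eqI)
  qed
  moreover have "x \<in> closure (- cbox a b)"
    using assms(3) by (simp add: closure_complement)
  moreover have "continuous_on (closure (- cbox a b)) (pd v f)"
    using assms(1,4) by (intro smooth_continuous_on smooth_pd)
  ultimately show ?thesis using continuous_constant_on_closure by blast
qed

lemma D_eq_0_outside:
  "smooth f \<Longrightarrow> (\<And>x. x \<notin> cbox a b \<Longrightarrow> f x = 0) \<Longrightarrow>
      x \<notin> box a b \<Longrightarrow> D i f x = 0"
  by (rule pd_eq_0_outside) (auto simp: axis_in_Basis_iff)

section \<open>Splitting along coordinate directions\<close>

definition diag_grad :: "('n::finite \<Rightarrow> real^'n \<Rightarrow> real) \<Rightarrow> real^'n \<Rightarrow> real^'n" where
  "diag_grad \<Phi> x = (\<chi> i. D i (\<Phi> i) x)"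

text \<open>For \<open>n = 2\<close>, \<open>\<Phi> 1\<close> is the perturbation of \<open>u\<close> and \<open>\<Phi> 2\<close> that of the stream function \<open>v\<close>;
  \<open>M i\<close> bounds the derivatives of \<open>\<Phi> i\<close> across its own direction, which a laminate makes small.\<close>

definition admissible :: "('n::finite \<Rightarrow> real^'n \<Rightarrow> real) \<Rightarrow> ('n \<Rightarrow> real) \<Rightarrow> bool" where
  "admissible \<Phi> M \<longleftrightarrow> (\<forall>i. smooth (\<Phi> i) \<and>
      (\<forall>x. x \<notin> cbox 0 1 \<longrightarrow> \<Phi> i x = 0) \<and>
     (\<forall>j x. j \<noteq> i \<longrightarrow> \<bar>D j (\<Phi> i) x\<bar> \<le> M i))"

text \<open>The unit cube has measure 1, so this is a mean value; \<open>X\<close> plays the role of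
  the barycentre, around which the perturbation oscillates.\<close>

definition cost :: "(real^'n::finite \<Rightarrow> real) \<Rightarrow> real^'n \<Rightarrow> ('n \<Rightarrow> real^'n \<Rightarrow> real) \<Rightarrow> real" where
  "cost g X \<Phi> = integral (cbox 0 1) (\<lambda>x. g (X + diag_grad \<Phi> x))"

lemma continuous_on_cost_integrand:
  assumes "continuous_on UNIV g" "\<And>i. smooth (\<Phi> i)"
  shows "continuous_on S (\<lambda>x. g (X + diag_grad \<Phi> x))"
  unfolding diag_grad_def
  by (intro continuous_on_compose2[OF assms(1)] continuous_intros smooth_continuous_on smooth_D assms) auto

section \<open>Inserting rescaled perturbations into sub-boxes\<close>

lemma rescale_ineqs:
  fixes c d x :: real
  assumes "c < d"
  shows "0 < x / (d - c) + - c / (d - c) \<longleftrightarrow> c < x" "x / (d - c) + - c / (d - c) < 1 \<longleftrightarrow> x < d"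
    "0 \<le> x / (d - c) + - c / (d - c) \<longleftrightarrow> c \<le> x" "x / (d - c) + - c / (d - c) \<le>
        1 \<longleftrightarrow> x \<le> d"
proof -
  have "x / (d - c) + - c / (d - c) = (x - c) / (d - c)" by (simp add: diff_divide_distrib)
  then show "0 < x / (d - c) + - c / (d - c) \<longleftrightarrow> c < x" "x / (d - c) + - c / (d - c) < 1 \<longleftrightarrow> x < d"
    "0 \<le> x / (d - c) + - c / (d - c) \<longleftrightarrow> c \<le> x" "x / (d - c) + - c / (d - c) \<le>
        1 \<longleftrightarrow> x \<le> d"
    using assms by (simp_all add: zero_less_divide_iff zero_le_divide_iff)
qed

lemma has_integral_cbox_rescale:
  fixes h :: "real^'n::finite \<Rightarrow> real"
  assumes "(h has_integral I) (cbox 0 1)" "\<And>i. c $ i < d $ i"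
  shows "((\<lambda>x. h ((\<chi> k. x $ k / (d $ k - c $ k)) + (\<chi> k. - c $ k / (d $ k - c $ k))))
    has_integral ((\<Prod>k\<in>UNIV. d $ k - c $ k) * I)) (cbox c d)"
proof -
  define e where "e = (\<chi> k. - c $ k / (d $ k - c $ k))"
  define m where "m k = 1 / (d $ k - c $ k)" for k
  have pos: "d $ i - c $ i > 0" for i using assms(2) by (simp add: less_diff_eq)
  have m: "m k > 0" for k using pos by (simp add: m_def)
  have "((\<lambda>x. h (x + e)) has_integral I) (cbox (0 - e) (1 - e))"
    by (rule has_integral_shift_cbox[OF assms(1)])
  then have "((\<lambda>x. h ((\<chi> k. m k * x $ k) + e)) has_integral I /\<^sub>R \<bar>prod m UNIV\<bar>)
            ((\<lambda>x. \<chi> k. x $ k / m k) ` (cbox (0 - e) (1 - e)))"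
    by (rule has_integral_stretch_cart) (use m in \<open>simp add: less_imp_neq[symmetric]\<close>)
  moreover have "(\<lambda>x. \<chi> k. x $ k / m k) ` (cbox (0 - e) (1 - e)) = cbox c d"
  proof -
    have "y \<in> (\<lambda>x. \<chi> k. x $ k / m k) ` (cbox (0 - e) (1 - e)) \<longleftrightarrow> y \<in> cbox c d" for y
    proof -
      have "y \<in> (\<lambda>x. \<chi> k. x $ k / m k) ` (cbox (0 - e) (1 - e)) \<longleftrightarrow>
        (\<chi> k. m k * y $ k) \<in> cbox (0 - e) (1 - e)"
      proof
        assume "(\<chi> k. m k * y $ k) \<in> cbox (0 - e) (1 - e)"
        then show "y \<in> (\<lambda>x. \<chi> k. x $ k / m k) ` (cbox (0 - e) (1 - e))"
          by (rule rev_image_eqI) (use m in \<open>simp add: vec_eq_iff less_imp_neq[symmetric]\<close>)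
      next
        assume "y \<in> (\<lambda>x. \<chi> k. x $ k / m k) ` (cbox (0 - e) (1 - e))"
        then obtain x where x: "x \<in> cbox (0 - e) (1 - e)" "y = (\<chi> k. x $ k / m k)" by blast
        then have "(\<chi> k. m k * y $ k) = x" using m by (simp add: vec_eq_iff less_imp_neq[symmetric])
        then show "(\<chi> k. m k * y $ k) \<in> cbox (0 - e) (1 - e)" using x by simp
      qed
      also have "\<dots> \<longleftrightarrow> y \<in> cbox c d"
      proof -
        have "(- e $ k \<le> m k * y $ k) = (c $ k \<le> y $ k)"
          "(m k * y $ k \<le> 1 - e $ k) = (y $ k \<le> d $ k)" for k
          using rescale_ineqs(3,4)[OF assms(2)[of k], of "y $ k"] unfolding e_def m_def by (simp_all add: algebra_simps)
        then show ?thesis by (simp add: mem_box_cart)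
      qed
      finally show ?thesis .
    qed
    then show ?thesis by blast
  qed
  moreover have "I /\<^sub>R \<bar>prod m UNIV\<bar> = (\<Prod>k\<in>UNIV. d $ k - c $ k) * I"
    using pos unfolding m_def by (simp add: prod_dividef abs_prod field_simps less_imp_le)
  ultimately show ?thesis unfolding e_def m_def by (simp add: field_simps)
qed

text \<open>Component i of the inserted copy has amplitude d_i - c_i. Its derivative in its own
  direction is therefore unaffected by the rescaling, however elongated the box, and its derivative
  in direction j gains the factor (d_i - c_i) / (d_j - c_j). Inside the box the old transversal
  derivatives vanish, so old and new bounds need not be added.\<close>

lemma insert_box:
  fixes \<Phi> \<Psi> :: "'n::finite \<Rightarrow> real^'n \<Rightarrow> real"
  assumes g: "continuous_on UNIV g"
    and \<Phi>: "admissible \<Phi> M" and \<Psi>: "admissible \<Psi> N"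
    and cd: "\<And>i. c $ i < d $ i" and sub: "cbox c d \<subseteq> cbox 0 1"
    and Y: "\<And>x. x \<in> box c d \<Longrightarrow> diag_grad \<Phi> x = Y"
    and off: "\<And>x i j. x \<in> box c d \<Longrightarrow> j \<noteq> i \<Longrightarrow> D j (\<Phi> i) x = 0"
    and bnd: "\<And>i j. j \<noteq> i \<Longrightarrow> (d $ i - c $ i) / (d $ j - c $ j) * N i \<le> M i"
  obtains \<Phi>' where "admissible \<Phi>' M"
    "\<And>i j x. x \<notin> box c d \<Longrightarrow> D j (\<Phi>' i) x = D j (\<Phi> i) x"
    "cost g X \<Phi>' = cost g X \<Phi> + (\<Prod>k\<in>UNIV. d $ k - c $ k) * (cost g (X + Y) \<Psi> - g (X + Y))"
proof -
  define L where "L x = (\<chi> k. x $ k / (d $ k - c $ k))" for x :: "real^'n"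
  define e where "e = (\<chi> k. - c $ k / (d $ k - c $ k))"
  define \<Phi>' where "\<Phi>' i x = \<Phi> i x + (d $ i - c $ i) * \<Psi> i (L x + e)" for i x
  have pos: "d $ i - c $ i > 0" for i using cd by (simp add: less_diff_eq)
  have L: "bounded_linear L" unfolding L_def
    by (intro linear_conv_bounded_linear[THEN iffD1] linearI) (auto simp: vec_eq_iff add_divide_distrib)
  have Lax: "L (axis j 1) = (1 / (d $ j - c $ j)) *\<^sub>R axis j 1" for j
    by (auto simp: L_def vec_eq_iff axis_def)
  have s\<Phi>: "smooth (\<Phi> i)" and s\<Psi>: "smooth (\<Psi> i)" for i
    using \<Phi> \<Psi> by (auto simp: admissible_def)
  have s1: "smooth (\<lambda>x. (d $ i - c $ i) * \<Psi> i (L x + e))" for i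
    by (intro smooth_mult smooth_const smooth_compose_affine L s\<Psi>)
  have s': "smooth (\<Phi>' i)" for i
    unfolding \<Phi>'_def[abs_def] by (intro smooth_add s\<Phi> s1)
  have mem: "L x + e \<in> box 0 1 \<longleftrightarrow> x \<in> box c d" "L x + e \<in> cbox 0 1 \<longleftrightarrow> x \<in> cbox c d" for x
  proof -
    have "(0 < (L x + e) $ k) = (c $ k < x $ k)" "((L x + e) $ k < 1) = (x $ k < d $ k)"
      "(0 \<le> (L x + e) $ k) = (c $ k \<le> x $ k)" "((L x + e) $ k \<le> 1) = (x $ k \<le> d $ k)" for k
      using rescale_ineqs[OF cd[of k], of "x $ k"] by (simp_all add: L_def e_def)
    then show "L x + e \<in> box 0 1 \<longleftrightarrow> x \<in> box c d" "L x + e \<in> cbox 0 1 \<longleftrightarrow> x \<in> cbox c d"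
      by (simp_all add: mem_box_cart)
  qed
  have D1: "D j (\<lambda>x. \<Psi> i (L x + e)) x = D j (\<Psi> i) (L x + e) / (d $ j - c $ j)" for i j x
  proof -
    have "D j (\<lambda>x. \<Psi> i (L x + e)) x = frechet_derivative (\<Psi> i) (at (L x + e)) (L (axis j 1))"
      by (rule pd_compose_affine[OF L smooth_differentiable[OF s\<Psi>]])
    also have "\<dots> = D j (\<Psi> i) (L x + e) / (d $ j - c $ j)"
      unfolding Lax pd_def
      using linear_frechet_derivative[OF smooth_differentiable[OF s\<Psi>]]
      by (simp add: linear_scale)
    finally show ?thesis .
  qed
  have D': "D j (\<Phi>' i) x = D j (\<Phi> i) x + (d $ i - c $ i) / (d $ j - c $ j) * D j (\<Psi> i) (L x + e)" for i j x
  proof -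
    have "D j (\<Phi>' i) x = D j (\<Phi> i) x + D j (\<lambda>x. (d $ i - c $ i) * \<Psi> i (L x + e)) x"
      unfolding \<Phi>'_def[abs_def] by (intro pd_add smooth_differentiable s\<Phi> s1)
    also have "D j (\<lambda>x. (d $ i - c $ i) * \<Psi> i (L x + e)) x =
       (d $ i - c $ i) * D j (\<lambda>x. \<Psi> i (L x + e)) x + D j (\<lambda>x. d $ i - c $ i) x * \<Psi> i (L x + e)"
      by (intro pd_mult smooth_differentiable smooth_const smooth_compose_affine L s\<Psi>)
    also have "D j (\<lambda>x. d $ i - c $ i) x = 0" by (rule pd_eqI) auto
    finally show ?thesis by (simp add: D1)
  qed
  have D\<Psi>0: "D j (\<Psi> i) (L x + e) = 0" if "x \<notin> box c d" for i j x
    by (rule D_eq_0_outside[OF s\<Psi>, of 0 1]) (use that mem \<Psi> in \<open>auto simp: admissible_def\<close>)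
  have diff: "D j (\<Phi>' i) x = D j (\<Phi> i) x" if "x \<notin> box c d" for i j x
    unfolding D' D\<Psi>0[OF that] by simp
  have adm: "admissible \<Phi>' M"
    unfolding admissible_def
  proof (intro allI conjI impI)
    show "smooth (\<Phi>' i)" for i by (rule s')
    show "\<Phi>' i x = 0" if "x \<notin> cbox 0 1" for i x
    proof -
      have "L x + e \<notin> cbox 0 1" using that sub mem by blast
      then show ?thesis using that \<Phi> \<Psi> by (simp add: \<Phi>'_def admissible_def)
    qed
    show "\<bar>D j (\<Phi>' i) x\<bar> \<le> M i" if "j \<noteq> i" for i j x
    proof (cases "x \<in> box c d")
      case False
      then show ?thesis using diff \<Phi> that by (auto simp: admissible_def)
    next
      case True
      have "\<bar>D j (\<Phi>' i) x\<bar> = (d $ i - c $ i) / (d $ j - c $ j) * \<bar>D j (\<Psi> i) (L x + e)\<bar>"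
        using pos[of i] pos[of j] by (simp add: D' off[OF True that] abs_mult)
      also have "\<dots> \<le> (d $ i - c $ i) / (d $ j - c $ j) * N i"
        using \<Psi> that pos[of i] pos[of j] by (intro mult_left_mono) (auto simp: admissible_def)
      finally show ?thesis using bnd[OF that] by simp
    qed
  qed
  define G where "G y = g (X + Y + diag_grad \<Psi> y)" for y
  have dg': "diag_grad \<Phi>' x = diag_grad \<Phi> x + diag_grad \<Psi> (L x + e)" for x
    using pos by (simp add: diag_grad_def vec_eq_iff D' less_imp_neq[symmetric])
  have dg0: "diag_grad \<Psi> (L x + e) = 0" if "x \<notin> box c d" for x
    using D\<Psi>0[OF that] by (simp add: diag_grad_def vec_eq_iff)
  \<comment> \<open>Both sides vanish off the box, so the change of cost is an integral over the box
    alone.\<close>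
  have K: "G (L x + e) - g (X + Y) = g (X + diag_grad \<Phi>' x) - g (X + diag_grad \<Phi> x)" for x
  proof (cases "x \<in> box c d")
    case True
    then show ?thesis by (simp add: G_def dg' Y add.assoc)
  next
    case False
    then show ?thesis by (simp add: G_def dg' dg0)
  qed
  have "(G has_integral (cost g (X + Y) \<Psi>)) (cbox 0 1)"
    unfolding cost_def G_def by (intro integrable_integral integrable_continuous continuous_on_cost_integrand g s\<Psi>)
  from has_integral_cbox_rescale[OF this cd]
  have "((\<lambda>x. G (L x + e)) has_integral ((\<Prod>k\<in>UNIV. d $ k - c $ k) * cost g (X + Y) \<Psi>)) (cbox c d)"
    by (simp add: L_def e_def)
  moreover have "((\<lambda>x. g (X + Y)) has_integral ((\<Prod>k\<in>UNIV. d $ k - c $ k) * g (X + Y))) (cbox c d)"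
  proof -
    have "cbox c d \<noteq> {}" using cd by (auto simp: interval_eq_empty_cart not_less intro: less_imp_le)
    then show ?thesis using has_integral_const[of "g (X + Y)" c d] by (simp add: content_cbox_cart)
  qed
  ultimately have "((\<lambda>x. G (L x + e) - g (X + Y)) has_integral
     ((\<Prod>k\<in>UNIV. d $ k - c $ k) * (cost g (X + Y) \<Psi> - g (X + Y)))) (cbox c d)"
    unfolding right_diff_distrib by (rule has_integral_diff)
  then have "((\<lambda>x. G (L x + e) - g (X + Y)) has_integral
     ((\<Prod>k\<in>UNIV. d $ k - c $ k) * (cost g (X + Y) \<Psi> - g (X + Y)))) (cbox 0 1)"
  proof (rule has_integral_on_superset[OF _ _ sub])
    show "G (L x + e) - g (X + Y) = 0" if "x \<notin> cbox c d" for x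
    proof -
      have "x \<notin> box c d" using that box_subset_cbox by blast
      then show ?thesis by (simp add: G_def dg0)
    qed
  qed
  then have "((\<lambda>x. g (X + diag_grad \<Phi>' x) - g (X + diag_grad \<Phi> x)) has_integral
     ((\<Prod>k\<in>UNIV. d $ k - c $ k) * (cost g (X + Y) \<Psi> - g (X + Y)))) (cbox 0 1)"
    unfolding K .
  moreover have "((\<lambda>x. g (X + diag_grad \<Phi>' x) - g (X + diag_grad \<Phi> x)) has_integral
     (cost g X \<Phi>' - cost g X \<Phi>)) (cbox 0 1)"
    unfolding cost_def
    by (intro has_integral_diff integrable_integral integrable_continuous continuous_on_cost_integrand g s\<Phi> s')
  ultimately have "cost g X \<Phi>' - cost g X \<Phi> = (\<Prod>k\<in>UNIV. d $ k - c $ k) * (cost g (X + Y) \<Psi> - g (X + Y))"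
    using has_integral_unique by blast
  then show thesis by (intro that[OF adm diff]) auto
qed

lemma pd_bounded:
  assumes "smooth f" "\<And>x. x \<notin> cbox a b \<Longrightarrow> f x = 0" "v \<in> Basis"
  obtains C where "C \<ge> 0" "\<And>x. \<bar>pd v f x\<bar> \<le> C"
proof -
  have "bounded (pd v f ` cbox a b)"
    by (intro compact_imp_bounded compact_continuous_image smooth_continuous_on smooth_pd assms) auto
  then obtain C where C: "\<And>x. x \<in> cbox a b \<Longrightarrow> \<bar>pd v f x\<bar> \<le> C"
    by (auto simp: bounded_iff)
  have "pd v f x = 0" if "x \<notin> cbox a b" for x
    using pd_eq_0_outside[OF assms(1,2) _ assms(3)] that box_subset_cbox by blast
  with C have "\<bar>pd v f x\<bar> \<le> max C 0" for x
    by (cases "x \<in> cbox a b") (auto intro: max.coboundedI1)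
  then show thesis by (intro that[of "max C 0"]) auto
qed

text \<open>A profile in x_i with slopes \<alpha> and \<beta> is multiplied by a cut-off in x_j.
  Nothing controls the transversal derivative \<open>C\<close> as \<delta> shrinks, but the bound on
  \<open>diag_grad\<close> is independent of \<delta>; this lets \<open>achievable_split\<close>
  bound the cost of the transition zone before choosing \<delta>.\<close>

lemma split_base:
  fixes i j :: 2 and \<alpha> \<beta> \<mu> \<delta> :: real
  assumes ij: "i \<noteq> j" and l: "0 < \<mu>" "\<mu> < 1" and d: "0 < \<delta>" "\<delta> < \<mu> * (1 - \<delta>)" "\<delta> < (1 - \<mu>) * (1 - \<delta>)"
    and bal: "\<mu> * \<alpha> + (1 - \<mu>) * \<beta> = 0"
  obtains \<Phi> C where "C \<ge> 0" "admissible \<Phi> (\<lambda>k. if k = i then C else 0)"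
    "\<And>x. \<delta> \<le> x $ j \<Longrightarrow> x $ j \<le> 1 - \<delta> \<Longrightarrow> \<delta> \<le> x $ i \<Longrightarrow>
        x $ i \<le> \<mu> * (1 - \<delta>) \<Longrightarrow>
       diag_grad \<Phi> x = axis i \<alpha> \<and> (\<forall>k l. l \<noteq> k \<longrightarrow> D l (\<Phi> k) x = 0)"
    "\<And>x. \<delta> \<le> x $ j \<Longrightarrow> x $ j \<le> 1 - \<delta> \<Longrightarrow>
        \<mu> * (1 - \<delta>) + \<delta> \<le> x $ i \<Longrightarrow> x $ i \<le> 1 - \<delta> \<Longrightarrow>
       diag_grad \<Phi> x = axis i \<beta> \<and> (\<forall>k l. l \<noteq> k \<longrightarrow> D l (\<Phi> k) x = 0)"
    "\<And>x. norm (diag_grad \<Phi> x) \<le> 2 * (\<bar>\<alpha>\<bar> + \<bar>\<beta>\<bar>)"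
proof -
  obtain T S b :: "real \<Rightarrow> real" and c :: real where T: "\<And>x. (T has_real_derivative S x) (at x)"
    and S: "\<And>x. (S has_real_derivative b x) (at x)"
    and C: "\<And>k. C_k k T" "\<And>k. C_k k S" "\<And>k. C_k k b"
    and T0: "\<And>x. x \<le> 0 \<Longrightarrow> T x = 0" and T1: "\<And>x. 1 \<le> x \<Longrightarrow> T x = x - c"
    and S0: "\<And>x. x \<le> 0 \<Longrightarrow> S x = 0" and S1: "\<And>x. 1 \<le> x \<Longrightarrow> S x = 1" and "mono S"
    by (rule smooth_ramp) (rule that, assumption+)
  have S01: "0 \<le> S x" "S x \<le> 1" for x
    using monoD[OF \<open>mono S\<close>, of "min x 0" x] monoD[OF \<open>mono S\<close>, of x "max x 1"] S0[of "min x 0"] S1[of "max x 1"] by auto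
  have sm: "smooth T" "smooth S" "smooth b" using C by (auto simp: smooth_def)
  define q where "q m s = s / \<delta> + (- (m / \<delta>))" for m s
  have q0: "q m s \<le> 0" if "s \<le> m" for m s using that d by (simp add: q_def divide_right_mono)
  have q1: "1 \<le> q m s" if "m + \<delta> \<le> s" for m s
  proof -
    have "q m s = (s - m) / \<delta>" by (simp add: q_def diff_divide_distrib)
    then show ?thesis using that d by simp
  qed
  have smq: "smooth (\<lambda>s. f (q m s))" if "smooth f" for f :: "real \<Rightarrow> real" and m
    unfolding q_def by (intro smooth_compose_affine bounded_linear_divide that)
  \<comment> \<open>The slope jumps \<alpha>, \<beta> - \<alpha>, -\<beta> sum to 0, so the delay
    \<open>c\<close> of the ramps cancels. With ramps of equal width starting at 0, \<mu> (1 -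
    \<delta>) and 1 - \<delta>, the final value is exactly (1 - \<delta>) (\<mu> \<alpha> + (1 -
    \<mu>) \<beta>) = 0.\<close>
  define w where "w s = \<delta> * (\<alpha> * T (q 0 s) + ((\<beta> - \<alpha>) * T (q (\<mu> * (1 - \<delta>)) s) + (-\<beta>) * T (q (1 - \<delta>) s)))" for s
  define w' where "w' s = \<alpha> * S (q 0 s) + (\<beta> - \<alpha>) * S (q (\<mu> * (1 - \<delta>)) s) - \<beta> * S (q (1 - \<delta>) s)" for s
  define \<chi>f where "\<chi>f s = S (q 0 s) + (- 1) * S (q (1 - \<delta>) s)" for s
  define \<chi>f' where "\<chi>f' s = (b (q 0 s) - b (q (1 - \<delta>) s)) / \<delta>" for s
  have dq: "(q m has_real_derivative 1 / \<delta>) (at s)" for m s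
    unfolding q_def[abs_def] using d by (auto intro!: derivative_eq_intros)
  have dw: "(w has_real_derivative w' s) (at s)" for s
    unfolding w_def[abs_def] w'_def using d
    by (auto intro!: derivative_eq_intros DERIV_chain2[OF T dq] simp: field_simps)
  have d\<chi>: "(\<chi>f has_real_derivative \<chi>f' s) (at s)" for s
    unfolding \<chi>f_def[abs_def] \<chi>f'_def using d
    by (auto intro!: derivative_eq_intros DERIV_chain2[OF S dq] simp: field_simps)
  have sw: "smooth w" unfolding w_def[abs_def]
    by (intro smooth_add smooth_mult smooth_const smq sm)
  have s\<chi>: "smooth \<chi>f" unfolding \<chi>f_def[abs_def]
    by (intro smooth_add smooth_mult smooth_const smq sm)
  have dl: "\<delta> < 1 / 2"
  proof -
    have "\<delta> + \<delta> < \<mu> * (1 - \<delta>) + (1 - \<mu>) * (1 - \<delta>)" using d by linarith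
    also have "\<dots> = 1 - \<delta>" by (simp add: algebra_simps)
    finally show ?thesis using d by simp
  qed
  have w0: "w s = 0" if "s < 0 \<or> 1 < s" for s
  proof (cases "s < 0")
    case True
    have "q 0 s \<le> 0" "q (\<mu> * (1 - \<delta>)) s \<le> 0" "q (1 - \<delta>) s \<le> 0" using True d dl by (auto intro!: q0)
    then show ?thesis by (simp add: w_def T0)
  next
    case False
    have "1 \<le> q 0 s" "1 \<le> q (\<mu> * (1 - \<delta>)) s" "1 \<le> q (1 - \<delta>) s"
      using False that d dl by (auto intro!: q1 simp: algebra_simps)
    then have "w s = \<delta> * (\<alpha> * (q 0 s - c) + ((\<beta> - \<alpha>) * (q (\<mu> * (1 - \<delta>)) s - c) + (-\<beta>) * (q (1 - \<delta>) s - c)))"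
      by (simp add: w_def T1)
    also have "\<dots> = (1 - \<delta>) * (\<mu> * \<alpha> + (1 - \<mu>) * \<beta>)"
      using d by (simp add: q_def field_simps)
    finally show ?thesis using bal by simp
  qed
  have \<chi>0: "\<chi>f s = 0" if "s < 0 \<or> 1 < s" for s
  proof (cases "s < 0")
    case True
    have "q 0 s \<le> 0" "q (1 - \<delta>) s \<le> 0" using True d dl by (auto intro!: q0)
    then show ?thesis by (simp add: \<chi>f_def S0)
  next
    case False
    have "1 \<le> q 0 s" "1 \<le> q (1 - \<delta>) s" using False that d dl by (auto intro!: q1)
    then show ?thesis by (simp add: \<chi>f_def S1)
  qed
  have \<chi>1: "\<chi>f s = 1" if "\<delta> \<le> s" "s \<le> 1 - \<delta>" for s
    using q0[of s "1 - \<delta>"] q1[of 0 s] that by (simp add: \<chi>f_def S0 S1)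
  have \<chi>b: "\<bar>\<chi>f s\<bar> \<le> 1" for s
    using S01[of "q 0 s"] S01[of "q (1 - \<delta>) s"] by (auto simp: \<chi>f_def)
  have \<chi>'0: "\<chi>f' s = 0" if "\<delta> \<le> s" "s \<le> 1 - \<delta>" for s
  proof -
    \<comment> \<open>\<open>S\<close> is constant on each side of [0, 1], so its derivative
      \<open>b\<close> vanishes there; the two endpoints follow by continuity.\<close>
    have "b t = 0" if "t \<le> 0 \<or> 1 \<le> t" for t
    proof -
      have "b t' = 0" if t': "t' < 0 \<or> 1 < t'" for t'
      proof -
        have "((\<lambda>_. if t' < 0 then 0 else 1) has_real_derivative b t') (at t')"
          by (rule has_field_derivative_transform_within_open[OF S, where S="if t' < 0 then {..<0} else {1<..}"])
            (use t' in \<open>auto simp: S0 S1 split: if_splits\<close>)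
        then show ?thesis using DERIV_const DERIV_unique by blast
      qed
      then have "b t = 0" if "t \<in> {..<0} \<union> {1<..}" for t using that by auto
      moreover have "t \<in> closure ({..<0} \<union> {1<..})"
        using that by (auto simp: closure_Un)
      moreover have "continuous_on (closure ({..<0} \<union> {1<..})) b"
        by (intro smooth_continuous_on sm)
      ultimately show ?thesis using continuous_constant_on_closure by blast
    qed
    then show ?thesis using q0[of s "1 - \<delta>"] q1[of 0 s] that by (simp add: \<chi>f'_def)
  qed
  have w'b: "\<bar>w' s\<bar> \<le> 2 * (\<bar>\<alpha>\<bar> + \<bar>\<beta>\<bar>)" for s
  proof -
    have *: "\<bar>u * S t\<bar> \<le> \<bar>u\<bar>" for u t
      using S01[of t] mult_left_mono[of "S t" 1 "\<bar>u\<bar>"] by (simp add: abs_mult)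
    have "\<bar>w' s\<bar> \<le> \<bar>\<alpha>\<bar> + \<bar>\<beta> - \<alpha>\<bar> + \<bar>\<beta>\<bar>"
      using *[of \<alpha> "q 0 s"] *[of "\<beta> - \<alpha>" "q (\<mu> * (1 - \<delta>)) s"] *[of \<beta> "q (1 - \<delta>) s"] unfolding w'_def by linarith
    then show ?thesis using abs_triangle_ineq4[of \<beta> \<alpha>] by simp
  qed
  define \<Phi> where "\<Phi> k x = (if k = i then w (x $ i) * \<chi>f (x $ j) else 0)" for k :: 2 and x :: "real^2"
  have si: "smooth (\<lambda>x. w (x $ i) * \<chi>f (x $ j))"
    using smooth_compose_affine[OF bounded_linear_vec_nth sw, of i 0]
       smooth_compose_affine[OF bounded_linear_vec_nth s\<chi>, of j 0] by (intro smooth_mult) auto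
  have s\<Phi>: "smooth (\<Phi> k)" for k
    unfolding \<Phi>_def[abs_def] using si smooth_const[of 0] by (cases "k = i") simp_all
  have z\<Phi>: "\<Phi> k x = 0" if "x \<notin> cbox 0 1" for k x
  proof -
    have "x $ i < 0 \<or> 1 < x $ i \<or> x $ j < 0 \<or> 1 < x $ j"
      using that ij exhaust_2[of i] exhaust_2[of j] by (auto simp: mem_box_cart forall_2 not_le)
    then show ?thesis using w0 \<chi>0 by (auto simp: \<Phi>_def)
  qed
  have Di: "pd v (\<Phi> i) x = w (x $ i) * (v $ j * \<chi>f' (x $ j)) + v $ i * w' (x $ i) * \<chi>f (x $ j)" for v x
  proof -
    have 1: "((\<lambda>x. w (x $ i)) has_derivative (\<lambda>h. h $ i * w' (x $ i))) (at x)"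
      by (rule DERIV_compose_FDERIV[OF dw]) (rule bounded_linear_imp_has_derivative[OF bounded_linear_vec_nth])
    have 2: "((\<lambda>x. \<chi>f (x $ j)) has_derivative (\<lambda>h. h $ j * \<chi>f' (x $ j))) (at x)"
      by (rule DERIV_compose_FDERIV[OF d\<chi>]) (rule bounded_linear_imp_has_derivative[OF bounded_linear_vec_nth])
    show ?thesis
      using pd_eqI[OF has_derivative_mult[OF 1 2], of v] by (simp add: \<Phi>_def[abs_def])
  qed
  have Dk: "pd v (\<Phi> k) x = 0" if "k \<noteq> i" for v k x
    using that by (intro pd_eqI[where f'="\<lambda>_. 0"]) (simp add: \<Phi>_def[abs_def])
  have dg: "diag_grad \<Phi> x = axis i (w' (x $ i) * \<chi>f (x $ j))" for x
    using ij by (auto simp: diag_grad_def vec_eq_iff Di Dk axis_def)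
  have od: "D l (\<Phi> k) x = 0" if "\<delta> \<le> x $ j" "x $ j \<le> 1 - \<delta>" "l \<noteq> k" for k l x
    using that ij by (cases "k = i") (auto simp: Di Dk axis_def \<chi>'0)
  have axj: "axis j (1::real) \<in> Basis" by (auto simp: axis_in_Basis_iff)
  obtain C where C: "C \<ge> 0" "\<And>x. \<bar>D j (\<Phi> i) x\<bar> \<le> C"
    using pd_bounded[OF s\<Phi> z\<Phi> axj] by blast
  have adm: "admissible \<Phi> (\<lambda>k. if k = i then C else 0)"
  proof -
    have "\<bar>D l (\<Phi> k) x\<bar> \<le> (if k = i then C else 0)" if "l \<noteq> k" for k l x
    proof (cases "k = i")
      case True
      then have "l = j" using that ij exhaust_2[of i] exhaust_2[of j] exhaust_2[of l] by auto
      then show ?thesis using C True by simp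
    qed (simp add: Dk)
    then show ?thesis using s\<Phi> z\<Phi> by (auto simp: admissible_def)
  qed
  show thesis
  proof (rule that[OF C(1) adm])
    fix x :: "real^2" assume x: "\<delta> \<le> x $ j" "x $ j \<le> 1 - \<delta>"
    {
      assume "\<delta> \<le> x $ i" "x $ i \<le> \<mu> * (1 - \<delta>)"
      moreover have "\<mu> * (1 - \<delta>) \<le> 1 - \<delta>" using l dl by (simp add: mult_left_le_one_le)
      ultimately have "w' (x $ i) = \<alpha>"
        using q1[of 0 "x $ i"] q0[of "x $ i"] by (simp add: w'_def S0 S1)
      then show "diag_grad \<Phi> x = axis i \<alpha> \<and> (\<forall>k l. l \<noteq> k \<longrightarrow> D l (\<Phi> k) x = 0)"
        using x od \<chi>1 by (simp add: dg)
    next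
      assume "\<mu> * (1 - \<delta>) + \<delta> \<le> x $ i" "x $ i \<le> 1 - \<delta>"
      moreover have "0 \<le> \<mu> * (1 - \<delta>)" using l dl by simp
      ultimately have "w' (x $ i) = \<beta>"
        using q1[of _ "x $ i"] q0[of "x $ i"] by (simp add: w'_def S0 S1)
      then show "diag_grad \<Phi> x = axis i \<beta> \<and> (\<forall>k l. l \<noteq> k \<longrightarrow> D l (\<Phi> k) x = 0)"
        using x od \<chi>1 by (simp add: dg)
    }
  next
    fix x
    have "axis i t = t *\<^sub>R axis i (1::real)" for t by (simp add: vec_eq_iff axis_def)
    then have "norm (diag_grad \<Phi> x) = \<bar>w' (x $ i)\<bar> * \<bar>\<chi>f (x $ j)\<bar>"
      unfolding dg by (metis abs_mult mult.right_neutral norm_axis_1 norm_scaleR)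
    also have "\<dots> \<le> 2 * (\<bar>\<alpha>\<bar> + \<bar>\<beta>\<bar>) * 1" using w'b \<chi>b by (intro mult_mono) auto
    finally show "norm (diag_grad \<Phi> x) \<le> 2 * (\<bar>\<alpha>\<bar> + \<bar>\<beta>\<bar>)" by simp
  qed
qed

section \<open>Achievable mean costs and their convexity along the axes\<close>

definition achievable_with :: "(real^2 \<Rightarrow> real) \<Rightarrow> real^2 \<Rightarrow> (2 \<Rightarrow> real) \<Rightarrow> real \<Rightarrow> bool" where
  "achievable_with g X M t \<longleftrightarrow> (\<exists>\<Phi>. admissible \<Phi> M \<and> cost g X \<Phi> \<le> t)"

definition achievable :: "(real^2 \<Rightarrow> real) \<Rightarrow> real^2 \<Rightarrow> real \<Rightarrow> bool" where
  "achievable g X t \<longleftrightarrow> (\<forall>\<epsilon>>0. achievable_with g X (\<lambda>_. \<epsilon>) (t + \<epsilon>))"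

lemma admissible_mono: "admissible \<Phi> M \<Longrightarrow> (\<And>k. M k \<le> M' k) \<Longrightarrow> admissible \<Phi> M'"
  unfolding admissible_def by (meson order_trans)

lemma achievable_with_mono:
  "achievable_with g X M t \<Longrightarrow> (\<And>k. M k \<le> M' k) \<Longrightarrow> t \<le> t' \<Longrightarrow>
      achievable_with g X M' t'"
  unfolding achievable_with_def using admissible_mono by (meson order_trans)

lemma achievable_mono: "achievable g X t \<Longrightarrow> t \<le> t' \<Longrightarrow> achievable g X t'"
  unfolding achievable_def using achievable_with_mono by (metis add_right_mono order_refl)

lemma D_zero: "D j (\<lambda>_. 0) x = 0"
  by (rule pd_eqI) auto

lemma admissible_zero: "(\<And>k. M k \<ge> 0) \<Longrightarrow> admissible (\<lambda>_ _. 0) M"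
  by (auto simp: admissible_def smooth_const D_zero)

lemma measure_unit_cbox: "measure lborel (cbox 0 (1::real^'n::finite)) = 1"
proof -
  have "(1::real^'n) \<in> cbox 0 1" by (auto simp: mem_box_cart)
  then have "cbox 0 (1::real^'n) \<noteq> {}" by blast
  then show ?thesis by (simp add: content_cbox_cart)
qed

lemma cost_zero:
  fixes g :: "real^2 \<Rightarrow> real"
  shows "cost g X (\<lambda>_ _. 0) = g X"
proof -
  have "diag_grad (\<lambda>_ _. 0) x = 0" for x :: "real^2"
    by (simp add: diag_grad_def vec_eq_iff D_zero)
  then show ?thesis by (simp add: cost_def measure_unit_cbox)
qed

lemma achievable_self: "achievable g X (g X)"
  unfolding achievable_def achievable_with_def
  by (metis admissible_zero cost_zero less_eq_real_def add_increasing2 order_refl)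

lemma prod_2_cases:
  fixes i j :: 2 assumes "i \<noteq> j" shows "(\<Prod>k\<in>UNIV. f k) = f i * (f j :: real)"
  using assms exhaust_2[of i] exhaust_2[of j] by (auto simp: UNIV_2)

text \<open>Two copies, each squeezed by a factor 2 in direction \<open>i\<close>. Iterating this absorbs the transversal
  derivative that the cut-off in \<open>split_base\<close> creates.\<close>

lemma bisect:
  fixes i :: 2
  assumes g: "continuous_on UNIV g" and a: "achievable_with g X M t" and M: "\<And>k. M k \<ge> 0"
  shows "achievable_with g X (\<lambda>k. if k = i then M i / 2 else 2 * M k) t"
proof -
  define M' where "M' k = (if k = i then M i / 2 else 2 * M k)" for k
  obtain \<Psi> where \<Psi>: "admissible \<Psi> M" "cost g X \<Psi> \<le> t" using a by (auto simp: achievable_with_def)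
  obtain j where j: "j \<noteq> i" using exhaust_2[of i] by (metis zero_neq_one)
  have M': "M' k \<ge> 0" for k using M by (simp add: M'_def)
  define h where "h = (\<chi> k. if k = i then 1 / 2 else (1 :: real))"
  define e where "e = (\<chi> k. if k = i then 1 / 2 else (0 :: real))"
  have le: "h $ k \<le> 1" "0 \<le> e $ k" "0 < h $ k" "e $ k < 1" for k by (auto simp: h_def e_def)
  have ratio: "(h $ k - 0 $ k) / (h $ l - 0 $ l) * M k \<le> M' k"
       "(1 $ k - e $ k) / (1 $ l - e $ l) * M k \<le> M' k" if "l \<noteq> k" for k l
    using that j exhaust_2[of i] exhaust_2[of k] exhaust_2[of l] by (auto simp: h_def e_def M'_def)
  have disj: "x \<notin> box 0 h" if "x \<in> box e 1" for x
  proof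
    assume "x \<in> box 0 h"
    then have "x $ i < h $ i" by (auto simp: mem_box_cart)
    moreover have "e $ i < x $ i" using that by (auto simp: mem_box_cart)
    ultimately show False by (simp add: h_def e_def)
  qed
  have Z: "admissible (\<lambda>_ _. 0) M'" by (rule admissible_zero[OF M'])
  obtain \<Phi>1 where \<Phi>1: "admissible \<Phi>1 M'"
    "\<And>i j x. x \<notin> box 0 h \<Longrightarrow> D j (\<Phi>1 i) x = D j (\<lambda>_. 0) x"
    "cost g X \<Phi>1 = cost g X (\<lambda>_ _. 0) + (\<Prod>k\<in>UNIV. h $ k - 0 $ k) * (cost g (X + 0) \<Psi> - g (X + 0))"
  proof (rule insert_box[OF g Z \<Psi>(1), of 0 h 0 X])
    show "cbox 0 h \<subseteq> cbox 0 1" unfolding mem_box_cart subset_iff using le(1) by (simp, meson order_trans)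
  qed (use le ratio(1) in \<open>auto simp: diag_grad_def vec_eq_iff D_zero\<close>)
  obtain \<Phi>2 where \<Phi>2: "admissible \<Phi>2 M'"
    "\<And>i j x. x \<notin> box e 1 \<Longrightarrow> D j (\<Phi>2 i) x = D j (\<Phi>1 i) x"
    "cost g X \<Phi>2 = cost g X \<Phi>1 + (\<Prod>k\<in>UNIV. 1 $ k - e $ k) * (cost g (X + 0) \<Psi> - g (X + 0))"
  proof (rule insert_box[OF g \<Phi>1(1) \<Psi>(1), of e 1 0 X])
    show "cbox e 1 \<subseteq> cbox 0 1" unfolding mem_box_cart subset_iff using le(2) by (simp, meson order_trans)
  qed (use le ratio(2) in \<open>auto simp: diag_grad_def vec_eq_iff D_zero \<Phi>1(2)[OF disj]\<close>)
  \<comment> \<open>The two halves fill the square and each contributes half of the gain of \<Psi>,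
    so no cost is lost.\<close>
  have "cost g X \<Phi>2 = cost g X \<Psi>"
    unfolding \<Phi>2(3) \<Phi>1(3) prod_2_cases[OF j] using j by (simp add: cost_zero h_def e_def)
  then show ?thesis using \<Phi>2(1) \<Psi>(2) unfolding achievable_with_def M'_def by auto
qed

lemma bisect_iterate:
  fixes i :: 2
  assumes g: "continuous_on UNIV g" and a: "achievable_with g X M t" and M: "\<And>k. M k \<ge> 0"
  shows "achievable_with g X (\<lambda>k. if k = i then M i / 2 ^ n else 2 ^ n * M k) t"
proof (induction n)
  case 0
  have "(\<lambda>k. if k = i then M i / 2 ^ 0 else 2 ^ 0 * M k) = M" by auto
  then show ?case using a by simp
next
  case (Suc n)
  have "achievable_with g X (\<lambda>k. if k = i then (if i = i then M i / 2 ^ n else 2 ^ n * M i) / 2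
      else 2 * (if k = i then M i / 2 ^ n else 2 ^ n * M k)) t"
    by (rule bisect[OF g Suc]) (use M in auto)
  then show ?case by (rule achievable_with_mono) auto
qed

text \<open>Rank-one convexity, for the two rank-one directions used by the staircase.\<close>

lemma achievable_split:
  fixes i :: 2
  assumes g: "continuous_on UNIV g" and a1: "achievable g X1 t1" and a2: "achievable g X2 t2"
    and l: "0 < \<mu>" "\<mu> < 1" and X12: "\<And>k. k \<noteq> i \<Longrightarrow> X1 $ k = X2 $ k"
  shows "achievable g (\<mu> *\<^sub>R X1 + (1 - \<mu>) *\<^sub>R X2) (\<mu> * t1 + (1 - \<mu>) * t2)"
  unfolding achievable_def
proof (intro allI impI)
  fix \<epsilon> :: real assume e: "\<epsilon> > 0"
  define X where "X = \<mu> *\<^sub>R X1 + (1 - \<mu>) *\<^sub>R X2"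
  obtain j where j: "i \<noteq> j" using exhaust_2[of i] by (metis zero_neq_one)
  define \<alpha> where "\<alpha> = X1 $ i - X $ i"
  define \<beta> where "\<beta> = X2 $ i - X $ i"
  have bal: "\<mu> * \<alpha> + (1 - \<mu>) * \<beta> = 0" by (simp add: \<alpha>_def \<beta>_def X_def algebra_simps)
  have Xk: "X1 $ k = X $ k" "X2 $ k = X $ k" if "k \<noteq> i" for k
    using X12[OF that] by (simp_all add: X_def algebra_simps)
  have X1: "X + axis i \<alpha> = X1" and X2: "X + axis i \<beta> = X2"
    using Xk by (auto simp: vec_eq_iff axis_def \<alpha>_def \<beta>_def)
  \<comment> \<open>The \<delta>-independent gradient bound of \<open>split_base\<close>; it allows
    \<open>B\<close> to be fixed before \<delta>.\<close>
  define R where "R = 2 * (\<bar>\<alpha>\<bar> + \<bar>\<beta>\<bar>)"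
  have "bounded (g ` cball X R)"
    by (intro compact_imp_bounded compact_continuous_image continuous_on_subset[OF g]) auto
  then obtain B where "\<And>Z. Z \<in> cball X R \<Longrightarrow> \<bar>g Z\<bar> \<le> B"
    unfolding bounded_iff by (metis imageI real_norm_def)
  then have B: "g (X + Y) \<le> B" if "norm Y \<le> R" for Y
    using that by (force simp: dist_norm dest: abs_le_D1)
  \<comment> \<open>\<open>V1\<close> and \<open>V2\<close> are the areas of the two plateaus on
    which the pair equals \<open>X1\<close> and \<open>X2\<close>. The bound \<open>c\<close>
    charges \<open>B\<close> on the remaining area and tends to \<mu> t1 + (1 - \<mu>) t2 +
    \<epsilon> / 4 as \<delta> tends to 0.\<close>
  define V1 where "V1 \<delta> = (\<mu> * (1 - \<delta>) - \<delta>) * (1 - \<delta> - \<delta>)" for \<delta> :: real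
  define V2 where "V2 \<delta> = (1 - \<delta> - (\<mu> * (1 - \<delta>) + \<delta>)) * (1 - \<delta> - \<delta>)" for \<delta> :: real
  define c where "c \<delta> = V1 \<delta> * (t1 + \<epsilon> / 4) + V2 \<delta> * (t2 + \<epsilon> / 4) + (1 - V1 \<delta> - V2 \<delta>) * B" for \<delta>
  have small: "\<forall>\<^sub>F \<delta> in at_right 0. \<delta> < m * (1 - \<delta>)" if "0 < m" for m :: real
  proof -
    have "((\<lambda>\<delta>. m * (1 - \<delta>) - \<delta>) \<longlongrightarrow> m * (1 - 0) - 0) (at_right 0)" by (intro tendsto_intros)
    from order_tendstoD(1)[OF this, of 0] show ?thesis using that by simp
  qed
  have "\<forall>\<^sub>F \<delta> in at_right 0. \<delta> < \<mu> * (1 - \<delta>)" "\<forall>\<^sub>F \<delta> in at_right 0. \<delta> < (1 - \<mu>) * (1 - \<delta>)"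
    using small[of \<mu>] small[of "1 - \<mu>"] l by auto
  moreover have "\<forall>\<^sub>F \<delta> in at_right 0. c \<delta> < \<mu> * t1 + (1 - \<mu>) * t2 + \<epsilon> / 2"
  proof (rule order_tendstoD)
    show "(c \<longlongrightarrow> c 0) (at_right 0)" unfolding c_def[abs_def] V1_def V2_def by (intro tendsto_intros)
    show "c 0 < \<mu> * t1 + (1 - \<mu>) * t2 + \<epsilon> / 2" using e by (simp add: c_def V1_def V2_def field_simps)
  qed
  moreover have "\<forall>\<^sub>F \<delta> in at_right 0. (0::real) < \<delta>" by (simp add: eventually_at_filter)
  ultimately have "\<forall>\<^sub>F \<delta> in at_right 0. 0 < \<delta> \<and> \<delta> < \<mu> * (1 - \<delta>) \<and>
      \<delta> < (1 - \<mu>) * (1 - \<delta>) \<and> c \<delta> < \<mu> * t1 + (1 - \<mu>) * t2 + \<epsilon> / 2"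
    by eventually_elim auto
  then obtain \<delta> where d: "0 < \<delta>" "\<delta> < \<mu> * (1 - \<delta>)" "\<delta> < (1 - \<mu>) * (1 - \<delta>)" "c \<delta> < \<mu> * t1 + (1 - \<mu>) * t2 + \<epsilon> / 2"
    using eventually_happens' trivial_limit_at_right_real by blast
  have d2: "\<delta> < 1 - \<delta>" "\<mu> * (1 - \<delta>) + \<delta> < 1 - \<delta>"
    using d(1,2,3) l mult_left_le_one_le[of "1 - \<delta>" \<mu>] by (auto simp: algebra_simps)
  obtain \<Phi> C where C: "C \<ge> 0" and adm: "admissible \<Phi> (\<lambda>k. if k = i then C else 0)"
    and \<Phi>1: "\<And>x. \<delta> \<le> x $ j \<Longrightarrow> x $ j \<le> 1 - \<delta> \<Longrightarrow> \<delta> \<le>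
        x $ i \<Longrightarrow> x $ i \<le> \<mu> * (1 - \<delta>) \<Longrightarrow>
       diag_grad \<Phi> x = axis i \<alpha> \<and> (\<forall>k l. l \<noteq> k \<longrightarrow> D l (\<Phi> k) x = 0)"
    and \<Phi>2: "\<And>x. \<delta> \<le> x $ j \<Longrightarrow> x $ j \<le> 1 - \<delta> \<Longrightarrow>
        \<mu> * (1 - \<delta>) + \<delta> \<le> x $ i \<Longrightarrow> x $ i \<le> 1 - \<delta> \<Longrightarrow>
       diag_grad \<Phi> x = axis i \<beta> \<and> (\<forall>k l. l \<noteq> k \<longrightarrow> D l (\<Phi> k) x = 0)"
    and "\<And>x. norm (diag_grad \<Phi> x) \<le> 2 * (\<bar>\<alpha>\<bar> + \<bar>\<beta>\<bar>)"
    by (rule split_base[OF j l d(1-3) bal]) (rule that, assumption+)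
  then have nrm: "norm (diag_grad \<Phi> x) \<le> R" for x by (simp add: R_def)
  define c1 where "c1 = (\<chi> k::2. \<delta>)"
  define d1 where "d1 = (\<chi> k. if k = i then \<mu> * (1 - \<delta>) else 1 - \<delta>)"
  define c2 where "c2 = (\<chi> k. if k = i then \<mu> * (1 - \<delta>) + \<delta> else \<delta>)"
  define d2 where "d2 = (\<chi> k::2. 1 - \<delta>)"
  have box1: "x \<in> cbox c1 d1 \<longleftrightarrow> \<delta> \<le> x $ j \<and> x $ j \<le> 1 - \<delta> \<and> \<delta> \<le>
      x $ i \<and> x $ i \<le> \<mu> * (1 - \<delta>)" for x
    using j exhaust_2[of i] exhaust_2[of j] by (auto simp: mem_box_cart c1_def d1_def forall_2)
  have box2: "x \<in> cbox c2 d2 \<longleftrightarrow> \<delta> \<le> x $ j \<and> x $ j \<le> 1 - \<delta> \<and>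
      \<mu> * (1 - \<delta>) + \<delta> \<le> x $ i \<and> x $ i \<le> 1 - \<delta>" for x
    using j exhaust_2[of i] exhaust_2[of j] by (auto simp: mem_box_cart c2_def d2_def forall_2)
  have lt1: "c1 $ k < d1 $ k" and lt2: "c2 $ k < d2 $ k" for k
    using d d2 by (auto simp: c1_def d1_def c2_def d2_def)
  have mp: "0 < \<mu> * (1 - \<delta>)" "\<mu> * (1 - \<delta>) < 1 - \<delta>" using d d2 l by auto
  have sub1: "cbox c1 d1 \<subseteq> cbox 0 1" and sub2: "cbox c2 d2 \<subseteq> cbox 0 1"
    using d(1) d2 mp by (auto simp: mem_box_cart c1_def d1_def c2_def d2_def) (smt (verit))+
  have vol1: "(\<Prod>k\<in>UNIV. d1 $ k - c1 $ k) = V1 \<delta>" and vol2: "(\<Prod>k\<in>UNIV. d2 $ k - c2 $ k) = V2 \<delta>"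
    unfolding prod_2_cases[OF j] using j by (auto simp: c1_def d1_def c2_def d2_def V1_def V2_def)
  have V: "V1 \<delta> \<ge> 0" "V2 \<delta> \<ge> 0"
    unfolding vol1[symmetric] vol2[symmetric] using lt1 lt2 by (simp_all add: prod_nonneg less_imp_le)
  have disj: "x \<notin> cbox c1 d1" if "x \<in> cbox c2 d2" for x
    using that d(1) unfolding box1 box2 by auto
  have s\<Phi>: "smooth (\<Phi> k)" for k using adm by (simp add: admissible_def)
  have cost\<Phi>: "cost g X \<Phi> \<le> V1 \<delta> * g X1 + V2 \<delta> * g X2 + (1 - V1 \<delta> - V2 \<delta>) * B"
  proof -
    define f where "f x = B + (if x \<in> cbox c1 d1 then g X1 - B else 0) + (if x \<in> cbox c2 d2 then g X2 - B else 0)" for x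
    have "(f has_integral (1 * B + V1 \<delta> * (g X1 - B) + V2 \<delta> * (g X2 - B))) (cbox 0 1)"
      unfolding f_def
    proof (intro has_integral_add)
      have ne: "cbox c1 d1 \<noteq> {}" "cbox c2 d2 \<noteq> {}"
        using lt1 lt2 by (auto simp: interval_eq_empty_cart not_less intro: less_imp_le)
      show "((\<lambda>x. B) has_integral 1 * B) (cbox 0 (1::real^2))"
        using has_integral_const[of B 0 "1::real^2"] by (simp add: measure_unit_cbox)
      show "((\<lambda>x. if x \<in> cbox c1 d1 then g X1 - B else 0) has_integral V1 \<delta> * (g X1 - B)) (cbox 0 1)"
        using has_integral_const[of "g X1 - B" c1 d1] unfolding has_integral_restrict[OF sub1]
        by (simp add: content_cbox_cart ne vol1)
      show "((\<lambda>x. if x \<in> cbox c2 d2 then g X2 - B else 0) has_integral V2 \<delta> * (g X2 - B)) (cbox 0 1)"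
        using has_integral_const[of "g X2 - B" c2 d2] unfolding has_integral_restrict[OF sub2]
        by (simp add: content_cbox_cart ne vol2)
    qed
    moreover have "((\<lambda>x. g (X + diag_grad \<Phi> x)) has_integral cost g X \<Phi>) (cbox 0 1)"
      unfolding cost_def by (intro integrable_integral integrable_continuous continuous_on_cost_integrand g s\<Phi>)
    moreover have "g (X + diag_grad \<Phi> x) \<le> f x" for x
    proof -
      consider "x \<in> cbox c1 d1" "x \<notin> cbox c2 d2" | "x \<in> cbox c2 d2" "x \<notin> cbox c1 d1" | "x \<notin> cbox c1 d1" "x \<notin> cbox c2 d2"
        using disj by blast
      then show ?thesis
      proof cases
        case 1 then show ?thesis using \<Phi>1[of x] by (simp add: f_def box1 X1)
      next
        case 2 then show ?thesis using \<Phi>2[of x] by (simp add: f_def box2 X2)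
      next
        case 3 then show ?thesis using B[OF nrm] by (simp add: f_def)
      qed
    qed
    ultimately have "cost g X \<Phi> \<le> 1 * B + V1 \<delta> * (g X1 - B) + V2 \<delta> * (g X2 - B)"
      by (meson has_integral_le)
    then show ?thesis by (simp add: algebra_simps)
  qed
  \<comment> \<open>Order of choices: \<delta> determines \<open>C\<close>, \<open>C\<close> the
    number \<open>n\<close> of bisections, and \<open>n\<close> the size \<eta>. Bisecting n times
    divides the bound for component \<open>i\<close> by 2^n but multiplies that of the other
    component by 2^n, so the latter must be small beforehand.\<close>
  obtain n where n: "(C + 1) / \<epsilon> < 2 ^ n" using real_arch_pow[of 2] by auto
  define \<eta> where "\<eta> = min 1 (\<epsilon> / 4) / 2 ^ n"
  have \<eta>: "\<eta> > 0" "\<eta> \<le> 1" "\<eta> \<le> \<epsilon> / 4" "2 ^ n * \<eta> \<le> \<epsilon>"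
    using e by (auto simp: \<eta>_def divide_le_eq min_def mult_le_cancel_left1) (smt (verit) one_le_power mult_left_le mult_le_cancel_left1)+
  \<comment> \<open>The shortest side of the two boxes; it compensates for the ratios of sides that
    \<open>insert_box\<close> introduces.\<close>
  define \<kappa> where "\<kappa> = Min ((\<lambda>k. d1 $ k - c1 $ k) ` UNIV \<union> (\<lambda>k. d2 $ k - c2 $ k) ` UNIV)"
  have \<kappa>: "\<kappa> > 0" "\<And>k. \<kappa> \<le> d1 $ k - c1 $ k" "\<And>k. \<kappa> \<le> d2 $ k - c2 $ k"
    using lt1 lt2 by (auto simp: \<kappa>_def)
  have side: "d1 $ k - c1 $ k \<le> 1" "d2 $ k - c2 $ k \<le> 1" for k
    using d(1) d2 mp by (auto simp: c1_def d1_def c2_def d2_def)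
  have ke: "\<kappa> * \<eta> > 0" "\<kappa> * \<eta> \<le> \<epsilon> / 4"
  proof -
    show "\<kappa> * \<eta> > 0" using \<kappa>(1) \<eta>(1) by simp
    have "\<kappa> * \<eta> \<le> 1 * \<eta>"
      using \<eta>(1) order_trans[OF \<kappa>(2) side(1)[of i]] by (intro mult_right_mono) auto
    then show "\<kappa> * \<eta> \<le> \<epsilon> / 4" using \<eta>(3) by simp
  qed
  obtain \<Psi>1 where \<Psi>1: "admissible \<Psi>1 (\<lambda>_. \<kappa> * \<eta>)" "cost g X1 \<Psi>1 \<le> t1 + \<kappa> * \<eta>"
    using a1 ke(1) unfolding achievable_def achievable_with_def by blast
  obtain \<Psi>2 where \<Psi>2: "admissible \<Psi>2 (\<lambda>_. \<kappa> * \<eta>)" "cost g X2 \<Psi>2 \<le> t2 + \<kappa> * \<eta>"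
    using a2 ke(1) unfolding achievable_def achievable_with_def by blast
  define M where "M k = (if k = i then C + 1 else \<eta>)" for k
  have M\<eta>: "\<eta> \<le> M k" for k using \<eta> C by (auto simp: M_def)
  have adm': "admissible \<Phi> M"
    by (rule admissible_mono[OF adm]) (use \<eta>(1) in \<open>simp add: M_def\<close>)
  have ratio: "p / q * (\<kappa> * \<eta>) \<le> M k" if "0 < p" "p \<le> 1" "\<kappa> \<le> q" for p q k
  proof -
    have "p / q * (\<kappa> * \<eta>) = (p * (\<kappa> / q)) * \<eta>" by simp
    also have "\<dots> \<le> (1 * 1) * \<eta>"
      using that \<kappa> \<eta> by (intro mult_right_mono mult_mono) auto
    finally show ?thesis using M\<eta>[of k] by simp
  qed
  obtain \<Phi>' where \<Phi>': "admissible \<Phi>' M"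
    "\<And>i j x. x \<notin> box c1 d1 \<Longrightarrow> D j (\<Phi>' i) x = D j (\<Phi> i) x"
    "cost g X \<Phi>' = cost g X \<Phi> + (\<Prod>k\<in>UNIV. d1 $ k - c1 $ k) * (cost g (X + axis i \<alpha>) \<Psi>1 - g (X + axis i \<alpha>))"
  proof (rule insert_box[OF g adm' \<Psi>1(1) lt1 sub1, of "axis i \<alpha>" X])
    show "diag_grad \<Phi> x = axis i \<alpha>" "\<And>i j. j \<noteq> i \<Longrightarrow> D j (\<Phi> i) x =
        0" if "x \<in> box c1 d1" for x
      using \<Phi>1[of x] that box_subset_cbox[of c1 d1] box1[of x] by auto
    show "(d1 $ k - c1 $ k) / (d1 $ l - c1 $ l) * (\<kappa> * \<eta>) \<le> M k" for k l
      by (rule ratio) (use lt1[of k] side(1) \<kappa>(2) in auto)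
  qed (rule that, assumption+)
  have off1: "D k (\<Phi>' l) x = D k (\<Phi> l) x" if "x \<in> box c2 d2" for k l x
    using that disj box_subset_cbox \<Phi>'(2) by blast
  obtain \<Phi>'' where \<Phi>'': "admissible \<Phi>'' M"
    "cost g X \<Phi>'' = cost g X \<Phi>' + (\<Prod>k\<in>UNIV. d2 $ k - c2 $ k) * (cost g (X + axis i \<beta>) \<Psi>2 - g (X + axis i \<beta>))"
  proof (rule insert_box[OF g \<Phi>'(1) \<Psi>2(1) lt2 sub2, of "axis i \<beta>" X])
    show "diag_grad \<Phi>' x = axis i \<beta>" "\<And>i j. j \<noteq> i \<Longrightarrow> D j (\<Phi>' i) x =
        0" if "x \<in> box c2 d2" for x
      using \<Phi>2[of x] off1[OF that] that box_subset_cbox[of c2 d2] box2[of x] by (auto simp: diag_grad_def)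
    show "(d2 $ k - c2 $ k) / (d2 $ l - c2 $ l) * (\<kappa> * \<eta>) \<le> M k" for k l
      by (rule ratio) (use lt2[of k] side(2) \<kappa>(3) in auto)
  qed (rule that, assumption+)
  have "cost g X \<Phi>'' \<le> (V1 \<delta> * g X1 + V2 \<delta> * g X2 + (1 - V1 \<delta> - V2 \<delta>) * B) +
      V1 \<delta> * ((t1 + \<epsilon> / 4) - g X1) + V2 \<delta> * ((t2 + \<epsilon> / 4) - g X2)"
    unfolding \<Phi>''(2) \<Phi>'(3) X1 X2 vol1 vol2 using cost\<Phi> \<Psi>1(2) \<Psi>2(2) ke(2) V
    by (intro add_mono mult_left_mono diff_mono) auto
  also have "\<dots> = c \<delta>" by (simp add: c_def algebra_simps)
  finally have "achievable_with g X M (c \<delta>)" using \<Phi>''(1) by (auto simp: achievable_with_def)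
  from bisect_iterate[OF g this, of i n]
  have "achievable_with g X (\<lambda>k. if k = i then M i / 2 ^ n else 2 ^ n * M k) (c \<delta>)"
    using M\<eta> \<eta>(1) by (meson less_imp_le order_trans)
  then show "achievable_with g (\<mu> *\<^sub>R X1 + (1 - \<mu>) *\<^sub>R X2) (\<lambda>_. \<epsilon>) (\<mu> * t1 + (1 - \<mu>) * t2 + \<epsilon>)"
    unfolding X_def[symmetric]
  proof (rule achievable_with_mono)
    show "c \<delta> \<le> \<mu> * t1 + (1 - \<mu>) * t2 + \<epsilon>" using d(4) e by linarith
    have "(C + 1) / 2 ^ n \<le> \<epsilon>" using n e by (simp add: field_simps)
    then show "(if k = i then M i / 2 ^ n else 2 ^ n * M k) \<le> \<epsilon>" for k
      using \<eta>(4) by (simp add: M_def)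
  qed
qed

lemma achievable_split_1:
  assumes "continuous_on UNIV g" "achievable g (vector [a1, b]) t1" "achievable g (vector [a2, b]) t2"
    "0 < \<mu>" "\<mu> < 1" "a = \<mu> * a1 + (1 - \<mu>) * a2"
  shows "achievable g (vector [a, b]) (\<mu> * t1 + (1 - \<mu>) * t2)"
proof -
  have "vector [a, b] = \<mu> *\<^sub>R vector [a1, b] + (1 - \<mu>) *\<^sub>R (vector [a2, b] :: real^2)"
    using assms(6) by (simp add: vec_eq_iff forall_2 algebra_simps)
  moreover have "(vector [a1, b] :: real^2) $ k = vector [a2, b] $ k" if "k \<noteq> 1" for k
    using that exhaust_2[of k] by auto
  ultimately show ?thesis
    using achievable_split[OF assms(1-5), of 1] by simp
qed

lemma achievable_split_2:
  assumes "continuous_on UNIV g" "achievable g (vector [a, b1]) t1" "achievable g (vector [a, b2]) t2"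
    "0 < \<mu>" "\<mu> < 1" "b = \<mu> * b1 + (1 - \<mu>) * b2"
  shows "achievable g (vector [a, b]) (\<mu> * t1 + (1 - \<mu>) * t2)"
proof -
  have "vector [a, b] = \<mu> *\<^sub>R vector [a, b1] + (1 - \<mu>) *\<^sub>R (vector [a, b2] :: real^2)"
    using assms(6) by (simp add: vec_eq_iff forall_2 algebra_simps)
  moreover have "(vector [a, b1] :: real^2) $ k = vector [a, b2] $ k" if "k \<noteq> 2" for k
    using that exhaust_2[of k] by auto
  ultimately show ?thesis
    using achievable_split[OF assms(1-5), of 2] by simp
qed

section \<open>The staircase laminate\<close>

definition flux :: "real \<Rightarrow> real \<Rightarrow> real" where
  "flux \<theta> x = (1 + sqrt \<theta> * sin (pi * x)) * x"

text \<open>With \<open>X\<close> = (d1 u, d2 v), the first difference is the first component of F.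
  The cost is nonpositive wherever b = flux(a), that is at exact solutions.\<close>

definition defect_cost :: "real \<Rightarrow> real \<Rightarrow> real \<Rightarrow> real^2 \<Rightarrow> real" where
  "defect_cost \<theta> \<Lambda> r X = \<Lambda> * \<bar>flux \<theta> (X $ 1) - X $ 2\<bar> powr r - \<bar>X $ 1\<bar> powr r"

lemma continuous_on_defect_cost:
  assumes "r > 0"
  shows "continuous_on S (defect_cost \<theta> \<Lambda> r)"
  unfolding defect_cost_def[abs_def] flux_def using assms
  by (intro continuous_intros continuous_on_powr') auto

lemma flux_of_int: "flux \<theta> (of_int z) = of_int z"
  by (simp add: flux_def mult.commute)

context
  fixes \<theta> \<Lambda> r L \<sigma> :: real
  assumes \<theta>: "0 < \<theta>" "\<theta> < 1" and \<Lambda>: "\<Lambda> > 0" and r: "1 < r"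
    and L: "0 < L" and rL: "r < L / (1 + L) + 1 / (1 + L * (1 - \<theta>))"
    and \<sigma>: "\<sigma> = 1 \<or> \<sigma> = -1"
begin

abbreviation (input) "m \<equiv> L * (1 - \<theta>)"
abbreviation (input) "G \<equiv> defect_cost \<theta> \<Lambda> r"

text \<open>At the heights \<open>stair_x n\<close>, \<open>sin (pi * (\<sigma> * stair_x n)) = - sqrt \<theta>\<close>, so the coefficient is \<open>1 - \<theta>\<close>.
  The sign \<open>\<sigma>\<close> selects the branch through the fourth or through the second quadrant.\<close>

definition stair_x :: "nat \<Rightarrow> real" where
  "stair_x n = 2 * real n - arcsin (\<sigma> * sqrt \<theta>) / pi"

definition stair :: "nat \<Rightarrow> real^2" where
  "stair n = vector [\<sigma> * stair_x n, - (\<sigma> * m * stair_x n)]"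

lemma m_pos: "m > 0" using L \<theta> by simp

lemma contG: "continuous_on UNIV G" using r by (intro continuous_on_defect_cost) simp

lemma abs_sigma: "\<bar>\<sigma>\<bar> = 1"
  using \<sigma> by auto

lemma stair_x_Suc: "stair_x (Suc n) = stair_x n + 2"
  by (simp add: stair_x_def)

lemma stair_x_lower: "stair_x n \<ge> 2 * real n - 1 / 2"
proof -
  have "\<bar>\<sigma> * sqrt \<theta>\<bar> \<le> 1" using \<sigma> \<theta> by (auto simp: abs_mult)
  then have "arcsin (\<sigma> * sqrt \<theta>) \<le> pi / 2" by (intro arcsin_ubound) auto
  then have "arcsin (\<sigma> * sqrt \<theta>) / pi \<le> 1 / 2" using pi_gt_zero by (simp add: field_simps)
  then show ?thesis by (simp add: stair_x_def)
qed

lemma stair_x_at_top: "filterlim stair_x at_top sequentially"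
proof (rule filterlim_at_top_mono)
  show "filterlim (\<lambda>n. 2 * real n - 1 / 2) at_top sequentially" by real_asymp
qed (use stair_x_lower in auto)

lemma flux_stair_x: "flux \<theta> (\<sigma> * stair_x n) = \<sigma> * ((1 - \<theta>) * stair_x n)"
proof -
  have "\<bar>\<sigma> * sqrt \<theta>\<bar> \<le> 1" using \<sigma> \<theta> by (auto simp: abs_mult)
  then have s: "sin (arcsin (\<sigma> * sqrt \<theta>)) = \<sigma> * sqrt \<theta>" by (intro sin_arcsin) auto
  have "pi * stair_x n = 2 * real n * pi - arcsin (\<sigma> * sqrt \<theta>)"
    by (simp add: stair_x_def field_simps)
  then have 1: "sin (pi * stair_x n) = - (\<sigma> * sqrt \<theta>)"
    using s by (simp only: sin_diff sin_2npi cos_2npi)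
  have "sin (pi * (\<sigma> * stair_x n)) = - sqrt \<theta>"
    using \<sigma> 1 by auto
  then show ?thesis using \<theta> by (simp add: flux_def algebra_simps)
qed

text \<open>At an integer the flux equals its argument, so rounding m x to an integer
  \<open>z\<close> leaves a defect of at most 1, costing at most \<Lambda>. Rounding up keeps the
  gain at least (m x)^r.\<close>

lemma achievable_left:
  assumes "x > 0" "\<Lambda> \<le> (m * x) powr r"
  obtains z where "m * x \<le> z" "z \<le> m * x + 1"
    "achievable G (vector [- (\<sigma> * z), - (\<sigma> * m * x)]) (\<Lambda> - (m * x) powr r)"
proof -
  define z where "z = real_of_int \<lceil>m * x\<rceil>"
  have z: "m * x \<le> z" "z \<le> m * x + 1" unfolding z_def by linarith+
  have mx: "m * x > 0" using m_pos assms by simp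
  have f: "flux \<theta> (- (\<sigma> * z)) = - (\<sigma> * z)"
    using \<sigma> flux_of_int[of \<theta> "\<lceil>m * x\<rceil>"] flux_of_int[of \<theta> "- \<lceil>m * x\<rceil>"] by (auto simp: z_def)
  have "\<bar>- (\<sigma> * z) + \<sigma> * m * x\<bar> = \<bar>z - m * x\<bar>" using \<sigma> by (auto simp: algebra_simps)
  then have "\<bar>- (\<sigma> * z) + \<sigma> * m * x\<bar> powr r \<le> 1 powr r"
    using z r by (intro powr_mono2) auto
  moreover have "(m * x) powr r \<le> \<bar>- (\<sigma> * z)\<bar> powr r"
    using z mx r by (intro powr_mono2) (auto simp: abs_mult abs_sigma)
  ultimately have "G (vector [- (\<sigma> * z), - (\<sigma> * m * x)]) \<le> \<Lambda> - (m * x) powr r"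
    using \<Lambda> by (simp add: defect_cost_def f) (smt (verit) mult_left_le)
  then show thesis using achievable_mono[OF achievable_self] z that by blast
qed

text \<open>Up to the sign \<sigma>: the horizontal split sends the fraction 2 / (x + 2 + z) to the
  left point and the rest to (x + 2, -m x). The vertical split sends the fraction 2 m / ((1 -
  \<theta> + m) (x + 2)) = 2 L / ((1 + L) (x + 2)) of that to the exact line. Both resolved points
  have nonpositive cost, so only the surviving share of \<open>t\<close> remains. The step 2 is the
  period of sin(pi a).\<close>

lemma stair_step:
  assumes "x = stair_x n" "x > 0" "\<Lambda> \<le> (m * x) powr r" "achievable G (stair (Suc n)) t" "t \<ge> 0"
  shows "achievable G (stair n) ((1 - 2 / ((1 + m) * x + 3)) * (1 - 2 * L / ((1 + L) * (x + 2))) * t)"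
proof -
  obtain z where z: "m * x \<le> z" "z \<le> m * x + 1"
    and al: "achievable G (vector [- (\<sigma> * z), - (\<sigma> * m * x)]) (\<Lambda> - (m * x) powr r)"
    using achievable_left[OF assms(2,3)] .
  have mx: "m * x > 0" using m_pos assms by simp
  define \<mu>2 where "\<mu>2 = 1 - 2 * L / ((1 + L) * (x + 2))"
  have L1: "L / (1 + L) < 1" "0 < L / (1 + L)" using L by auto
  have \<mu>2eq: "\<mu>2 = 1 - L / (1 + L) * (2 / (x + 2))" by (simp add: \<mu>2_def)
  have x2: "0 < 2 / (x + 2)" "2 / (x + 2) < 1" using assms(2) by auto
  have "L / (1 + L) * (2 / (x + 2)) < 1 * 1" "0 < L / (1 + L) * (2 / (x + 2))"
    using L1 x2 by (intro mult_strict_mono mult_pos_pos; simp)+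
  then have \<mu>2: "0 < \<mu>2" "\<mu>2 < 1" by (simp_all add: \<mu>2eq)
  have "G (vector [\<sigma> * (x + 2), \<sigma> * ((1 - \<theta>) * (x + 2))]) \<le> 0"
    using flux_stair_x[of "Suc n"] unfolding stair_x_Suc assms(1)[symmetric] using r
    by (simp add: defect_cost_def)
  then have v0: "achievable G (vector [\<sigma> * (x + 2), \<sigma> * ((1 - \<theta>) * (x + 2))]) 0"
    using achievable_mono[OF achievable_self] by blast
  have vt: "achievable G (vector [\<sigma> * (x + 2), - (\<sigma> * m * (x + 2))]) t"
    using assms(4) unfolding stair_def stair_x_Suc assms(1)[symmetric] .
  have e2: "- (\<sigma> * m * x) = \<mu>2 * (- (\<sigma> * m * (x + 2))) + (1 - \<mu>2) * (\<sigma> * ((1 - \<theta>) * (x + 2)))"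
  proof -
    have "m * 2 = (1 - \<mu>2) * ((1 + L) * (x + 2)) * (1 - \<theta>)"
      using L assms(2) by (simp add: \<mu>2_def)
    then have "- (m * x) = \<mu>2 * (- (m * (x + 2))) + (1 - \<mu>2) * ((1 - \<theta>) * (x + 2))"
      by (simp add: algebra_simps)
    then have "\<sigma> * (- (m * x)) = \<sigma> * (\<mu>2 * (- (m * (x + 2))) + (1 - \<mu>2) * ((1 - \<theta>) * (x + 2)))"
      by (rule arg_cong)
    then show ?thesis by (simp add: algebra_simps)
  qed
  have v: "achievable G (vector [\<sigma> * (x + 2), - (\<sigma> * m * x)]) (\<mu>2 * t)"
    using achievable_split_2[OF contG vt v0 \<mu>2 e2] by simp
  define \<mu>1 where "\<mu>1 = 1 - 2 / (x + 2 + z)"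
  have \<mu>1: "0 < \<mu>1" "\<mu>1 < 1" using assms(2) mx z by (auto simp: \<mu>1_def)
  have e1: "\<sigma> * x = \<mu>1 * (\<sigma> * (x + 2)) + (1 - \<mu>1) * (- (\<sigma> * z))"
  proof -
    have "x + 2 + z \<noteq> 0" using assms(2) mx z by linarith
    moreover have "1 - \<mu>1 = 2 / (x + 2 + z)" by (simp add: \<mu>1_def)
    ultimately have "2 = (1 - \<mu>1) * (x + 2 + z)" by (metis nonzero_eq_divide_eq)
    then have "x = \<mu>1 * (x + 2) + (1 - \<mu>1) * (- z)" by (simp add: algebra_simps)
    then have "\<sigma> * x = \<sigma> * (\<mu>1 * (x + 2) + (1 - \<mu>1) * (- z))" by (rule arg_cong)
    then show ?thesis by (simp add: algebra_simps)
  qed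
  have "achievable G (stair n) (\<mu>1 * (\<mu>2 * t) + (1 - \<mu>1) * (\<Lambda> - (m * x) powr r))"
    unfolding stair_def assms(1)[symmetric] by (rule achievable_split_1[OF contG v al \<mu>1 e1])
  then show ?thesis
  proof (rule achievable_mono)
    have "\<mu>1 \<le> 1 - 2 / ((1 + m) * x + 3)"
    proof -
      \<comment> \<open>The offset 3 consists of the step 2 and the rounding error 1 of
        \<open>z\<close>.\<close>
      have "x + 2 + z \<le> (1 + m) * x + 3" using z by (simp add: algebra_simps)
      then have "2 / ((1 + m) * x + 3) \<le> 2 / (x + 2 + z)"
        using assms(2) mx z by (intro divide_left_mono mult_pos_pos) (auto intro!: add_nonneg_pos add_pos_pos mult_nonneg_nonneg)
      then show ?thesis by (simp add: \<mu>1_def)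
    qed
    then have "\<mu>1 * (\<mu>2 * t) \<le> (1 - 2 / ((1 + m) * x + 3)) * (\<mu>2 * t)"
      using \<mu>2 assms(5) by (intro mult_right_mono) auto
    moreover have "(1 - \<mu>1) * (\<Lambda> - (m * x) powr r) \<le> 0"
      using \<mu>1 assms(3) by (intro mult_nonneg_nonpos) auto
    ultimately show "\<mu>1 * (\<mu>2 * t) + (1 - \<mu>1) * (\<Lambda> - (m * x) powr r) \<le>
        (1 - 2 / ((1 + m) * x + 3)) * (1 - 2 * L / ((1 + L) * (x + 2))) * t"
      unfolding \<mu>2_def[symmetric] by (simp add: mult.assoc)
  qed
qed

text \<open>Let a, b be the fractions lost in the two splits. Then (1 - a) (1 - b) \<le> exp (-(a +
  b)), and x (a + b) / 2 tends to L / (1 + L) + 1 / (1 + m) > p, while ln (1 + 2/x) \<le> 2/x gives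
  exp (-2 p / x) \<le> (x / (x + 2))^p. The bound is stated as a power of a quotient because that
  telescopes along the heights.\<close>

lemma stair_factor:
  assumes p: "0 < p" "p < L / (1 + L) + 1 / (1 + m)"
  shows "\<forall>\<^sub>F x in at_top. (1 - 2 / ((1 + m) * x + 3)) * (1 - 2 * L / ((1 + L) * (x + 2))) \<le> (x / (x + 2)) powr p"
proof -
  define q where "q = 1 + m"
  define c where "c = L / (1 + L)"
  have q: "q > 0" and c: "c < 1" "0 < c" using m_pos L by (auto simp: q_def c_def)
  have z: "((\<lambda>x::real. a / x) \<longlongrightarrow> 0) at_top" for a :: real
    by (rule tendsto_divide_0[OF tendsto_const filterlim_at_top_imp_at_infinity[OF filterlim_ident]])
  have "((\<lambda>x. c * (1 / (1 + 2 / x)) + 1 / (q + 3 / x)) \<longlongrightarrow> c * (1 / (1 + 0)) + 1 / (q + 0)) at_top"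
    using q by (intro tendsto_intros z) auto
  moreover have "p < c * (1 / (1 + 0)) + 1 / (q + 0)" using p by (simp add: q_def c_def)
  ultimately have "\<forall>\<^sub>F x in at_top. p < c * (1 / (1 + 2 / x)) + 1 / (q + 3 / x)"
    by (rule order_tendstoD(1))
  then show ?thesis using eventually_gt_at_top[of 0]
  proof eventually_elim
    case (elim x)
    define a where "a = 2 / (q * x + 3)"
    define b where "b = c * (2 / (x + 2))"
    have ax: "a = 2 / x * (1 / (q + 3 / x))" and bx: "b = 2 / x * (c * (1 / (1 + 2 / x)))"
      using elim q by (simp_all add: a_def b_def field_simps)
    \<comment> \<open>The two exponential bounds may be multiplied only if 1 - b is
      nonnegative.\<close>
    have "c * (2 / (x + 2)) \<le> 1 * 1" using c elim by (intro mult_mono) auto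
    then have "b \<le> 1" by (simp add: b_def)
    then have "(1 - a) * (1 - b) \<le> exp (- a) * exp (- b)"
      using exp_ge_add_one_self[of "- a"] exp_ge_add_one_self[of "- b"] by (intro mult_mono) auto
    also have "\<dots> = exp (- (a + b))" by (simp add: exp_add[symmetric])
    also have "\<dots> \<le> exp (p * ln (x / (x + 2)))"
    proof -
      have "ln (1 + 2 / x) \<le> 2 / x" using elim by (intro ln_add_one_self_le_self) auto
      moreover have "ln (x / (x + 2)) = - ln (1 + 2 / x)"
        using elim by (simp add: ln_div field_simps)
      ultimately have "p * - (2 / x) \<le> p * ln (x / (x + 2))"
        using p by (intro mult_left_mono) auto
      moreover have "2 / x * p \<le> 2 / x * (c * (1 / (1 + 2 / x)) + 1 / (q + 3 / x))"
        using elim by (intro mult_left_mono) auto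
      then have "2 / x * p \<le> a + b" by (simp add: ax bx distrib_left)
      ultimately show ?thesis by (simp add: algebra_simps)
    qed
    also have "\<dots> = (x / (x + 2)) powr p" using elim by (simp add: powr_def)
    finally show ?case by (simp add: a_def b_def c_def q_def mult.commute)
  qed
qed

lemma powr_eventually_ge: "\<forall>\<^sub>F x in at_top. W \<le> (m * x) powr r"
  using eventually_ge_at_top[of "max 1 W / m"]
proof eventually_elim
  case (elim x)
  then have mx: "max 1 W \<le> m * x" using m_pos by (simp add: pos_divide_le_eq mult.commute)
  then have "(m * x) powr 1 \<le> (m * x) powr r" using r by (intro powr_mono) auto
  then show ?case using mx by simp
qed

text \<open>From height x to height y the factors telescope to (x / y)^p, and the unresolved end
  costs at most a multiple of y^r. As p > r, this tends to 0 with growing y; the bound 1 could be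
  any positive constant.\<close>

lemma achievable_stair: "\<forall>\<^sub>F n in sequentially. achievable G (stair n) 1"
proof -
  obtain p where p: "r < p" "p < L / (1 + L) + 1 / (1 + m)" using dense[OF rL] by blast
  have "\<forall>\<^sub>F x in at_top. (1 - 2 / ((1 + m) * x + 3)) * (1 - 2 * L / ((1 + L) * (x + 2))) \<le> (x / (x + 2)) powr p \<and>
     x \<ge> 1 \<and> \<Lambda> \<le> (m * x) powr r"
    using stair_factor[OF _ p(2)] eventually_ge_at_top[of 1] powr_eventually_ge[of \<Lambda>] p(1) r
    by (simp add: eventually_conj_iff)
  then obtain x0 where x0: "\<And>x. x \<ge> x0 \<Longrightarrow>
      (1 - 2 / ((1 + m) * x + 3)) * (1 - 2 * L / ((1 + L) * (x + 2))) \<le> (x / (x + 2)) powr p"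
    "\<And>x. x \<ge> x0 \<Longrightarrow> x \<ge> 1" "\<And>x. x \<ge> x0 \<Longrightarrow> \<Lambda> \<le> (m * x) powr r"
    unfolding eventually_at_top_linorder by auto
  \<comment> \<open>The full price of an unresolved end: there b = -m x lies at distance (1 -
    \<theta> + m) x from the flux (1 - \<theta>) x.\<close>
  define H where "H x = \<Lambda> * ((1 - \<theta> + m) * x) powr r" for x
  have km: "1 - \<theta> + m > 0" using m_pos \<theta> by simp
  have H: "H x \<ge> 0" for x using \<Lambda> by (simp add: H_def)
  have chain: "achievable G (stair n) ((stair_x n / stair_x (n + N)) powr p * H (stair_x (n + N)))"
    if "stair_x n \<ge> x0" for n N
    using that
  proof (induction N arbitrary: n)
    case 0
    have x: "stair_x n \<ge> 1" using x0 0 by blast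
    have "\<bar>\<sigma> * ((1 - \<theta>) * stair_x n) + \<sigma> * m * stair_x n\<bar> =
        \<bar>\<sigma>\<bar> * \<bar>(1 - \<theta> + m) * stair_x n\<bar>"
      unfolding abs_mult[symmetric] by (simp add: algebra_simps)
    also have "\<dots> = (1 - \<theta> + m) * stair_x n" using x km by (simp add: abs_sigma)
    finally have "\<bar>\<sigma> * ((1 - \<theta>) * stair_x n) + \<sigma> * m * stair_x n\<bar> = (1 - \<theta> + m) * stair_x n" .
    then have "G (stair n) \<le> H (stair_x n)"
      by (simp add: defect_cost_def stair_def flux_stair_x H_def)
    then show ?case using achievable_mono[OF achievable_self] x by simp
  next
    case (Suc N)
    define x where "x = stair_x n"
    define y where "y = stair_x (n + Suc N)"
    have x: "x \<ge> x0" "x \<ge> 1" using x0 Suc.prems by (auto simp: x_def)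
    have xS: "stair_x (Suc n) = x + 2" by (simp add: stair_x_Suc x_def)
    have y: "y > 0" using x by (simp add: x_def y_def stair_x_def)
    have t: "((x + 2) / y) powr p * H y \<ge> 0" using H by simp
    have "achievable G (stair (Suc n)) (((x + 2) / y) powr p * H y)"
      using Suc.IH[of "Suc n"] x by (simp add: xS y_def)
    from stair_step[OF x_def _ _ this t] have "achievable G (stair n)
       ((1 - 2 / ((1 + m) * x + 3)) * (1 - 2 * L / ((1 + L) * (x + 2))) * (((x + 2) / y) powr p * H y))"
      using x x0 by auto
    then have "achievable G (stair n) ((x / (x + 2)) powr p * (((x + 2) / y) powr p * H y))"
      by (rule achievable_mono) (intro mult_right_mono x0 x t)
    moreover have "(x / (x + 2)) powr p * ((x + 2) / y) powr p = (x / y) powr p"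
      using x y by (subst powr_mult[symmetric]) auto
    ultimately show ?case unfolding x_def[symmetric] y_def[symmetric] by (simp add: mult.assoc[symmetric])
  qed
  have "achievable G (stair n) 1" if n: "stair_x n \<ge> x0" for n
  proof -
    have x: "stair_x n \<ge> 1" using x0 n by blast
    have "filterlim (\<lambda>N. stair_x (n + N)) at_top sequentially"
      using filterlim_compose[OF stair_x_at_top, of "\<lambda>N. n + N"] by (simp add: filterlim_add_const_nat_at_top add.commute)
    then have "((\<lambda>N. stair_x (n + N) powr (r - p)) \<longlongrightarrow> 0) sequentially"
      using p by (intro tendsto_neg_powr) auto
    then have "((\<lambda>N. stair_x n powr p * \<Lambda> * (1 - \<theta> + m) powr r * stair_x (n + N) powr (r - p)) \<longlongrightarrow>
       stair_x n powr p * \<Lambda> * (1 - \<theta> + m) powr r * 0) sequentially"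
      by (intro tendsto_mult tendsto_const)
    then have "\<forall>\<^sub>F N in sequentially. stair_x n powr p * \<Lambda> * (1 - \<theta> + m) powr r * stair_x (n + N) powr (r - p) < 1"
      by (rule order_tendstoD(2)) simp
    then obtain N where N: "stair_x n powr p * \<Lambda> * (1 - \<theta> + m) powr r * stair_x (n + N) powr (r - p) < 1"
      using eventually_happens' sequentially_bot by blast
    have y: "stair_x (n + N) > 0" using x by (simp add: stair_x_def)
    have "(stair_x n / stair_x (n + N)) powr p * H (stair_x (n + N)) =
       stair_x n powr p * \<Lambda> * (1 - \<theta> + m) powr r * stair_x (n + N) powr (r - p)"
      using x y km by (simp add: H_def powr_divide powr_mult powr_diff)
    then show ?thesis using chain[OF n, of N] N achievable_mono by (metis less_imp_le)
  qed
  moreover have "\<forall>\<^sub>F n in sequentially. stair_x n \<ge> x0"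
    using stair_x_at_top by (simp add: filterlim_at_top)
  ultimately show ?thesis by (auto elim: eventually_mono)
qed

text \<open>One more horizontal split, and the one that yields the gain: the left point has weight x
  / (x + z) \<ge> 1 / (2 + m) and cost at most \<Lambda> - (m x)^r, which is unbounded below as the
  starting height x grows. The right point, the start of the staircase, costs at most 1.\<close>

lemma achievable_axis:
  obtains Y where "Y > 0" "achievable G (vector [0, - (\<sigma> * Y)]) (- K)"
proof -
  \<comment> \<open>Chosen so that the left point contributes at most -(\<bar>K\<bar> + 1) after
    weighting; the extra 1 pays for the staircase.\<close>
  define W where "W = \<Lambda> + (\<bar>K\<bar> + 1) * (2 + m)"
  have W: "\<Lambda> \<le> W" using m_pos by (simp add: W_def)
  have ev: "\<forall>\<^sub>F x in at_top. x \<ge> 1 \<and> W \<le> (m * x) powr r"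
    by (intro eventually_conj eventually_ge_at_top powr_eventually_ge)
  have "\<forall>\<^sub>F n in sequentially. (stair_x n \<ge> 1 \<and> W \<le> (m * stair_x n) powr r) \<and> achievable G (stair n) 1"
    by (intro eventually_conj achievable_stair eventually_compose_filterlim[OF ev stair_x_at_top])
  then obtain n where n: "stair_x n \<ge> 1" "W \<le> (m * stair_x n) powr r" "achievable G (stair n) 1"
    using eventually_happens' sequentially_bot by blast
  define x where "x = stair_x n"
  have x: "x \<ge> 1" "x > 0" and Wx: "W \<le> (m * x) powr r" using n by (auto simp: x_def)
  obtain z where z: "m * x \<le> z" "z \<le> m * x + 1"
    and al: "achievable G (vector [- (\<sigma> * z), - (\<sigma> * m * x)]) (\<Lambda> - (m * x) powr r)"
    using achievable_left[OF x(2) order_trans[OF W Wx]] .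
  have mx: "m * x > 0" using m_pos x by simp
  have ar: "achievable G (vector [\<sigma> * x, - (\<sigma> * m * x)]) 1"
    using n(3) by (simp add: stair_def x_def)
  define \<mu> where "\<mu> = z / (x + z)"
  have \<mu>: "0 < \<mu>" "\<mu> < 1" using x z mx by (auto simp: \<mu>_def)
  have e: "0 = \<mu> * (\<sigma> * x) + (1 - \<mu>) * (- (\<sigma> * z))"
    using x z mx by (simp add: \<mu>_def field_simps)
  have "achievable G (vector [0, - (\<sigma> * m * x)]) (\<mu> * 1 + (1 - \<mu>) * (\<Lambda> - (m * x) powr r))"
    by (rule achievable_split_1[OF contG ar al \<mu> e])
  then have "achievable G (vector [0, - (\<sigma> * m * x)]) (- K)"
  proof (rule achievable_mono)
    have "1 / (2 + m) \<le> 1 - \<mu>"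
    proof -
      have "x + z \<le> (2 + m) * x" using z x by (simp add: algebra_simps)
      then have "1 * (x + z) \<le> x * (2 + m)" by (simp add: mult.commute)
      moreover have "x + z > 0" using x z mx by linarith
      ultimately have "x / (x * (2 + m)) \<le> x / (x + z)"
        using x m_pos by (intro divide_left_mono mult_pos_pos) auto
      then have "1 / (2 + m) \<le> x / (x + z)" using x by simp
      also have "\<dots> = 1 - \<mu>" using x z mx by (simp add: \<mu>_def field_simps)
      finally show ?thesis .
    qed
    moreover have "\<Lambda> - (m * x) powr r \<le> - ((\<bar>K\<bar> + 1) * (2 + m))" using Wx by (simp add: W_def)
    moreover have "(\<bar>K\<bar> + 1) * (2 + m) \<ge> 0" using m_pos by simp
    ultimately have "1 / (2 + m) * ((\<bar>K\<bar> + 1) * (2 + m)) \<le> (1 - \<mu>) * ((m * x) powr r - \<Lambda>)"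
      using m_pos \<mu> by (intro mult_mono) auto
    moreover have "1 / (2 + m) * ((\<bar>K\<bar> + 1) * (2 + m)) = \<bar>K\<bar> + 1" using m_pos by simp
    moreover have "\<mu> * 1 \<le> 1" using \<mu> by simp
    moreover have "(1 - \<mu>) * (\<Lambda> - (m * x) powr r) = - ((1 - \<mu>) * ((m * x) powr r - \<Lambda>))" by (simp add: algebra_simps)
    ultimately show "\<mu> * 1 + (1 - \<mu>) * (\<Lambda> - (m * x) powr r) \<le> - K" by linarith
  qed
  then show thesis using that[of "m * x"] mx by (simp add: mult.assoc)
qed

end

text \<open>The two signs reach one point of the axis a = 0 below the origin and one above it; a
  vertical split joins them. The heights \<open>Y\<close> and \<open>Z\<close> may differ, which
  only affects the weight.\<close>

lemma achievable_origin:
  assumes "0 < \<theta>" "\<theta> < 1" "\<Lambda> > 0" "1 < r" "0 < L" "r < L / (1 + L) + 1 / (1 + L * (1 - \<theta>))"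
  shows "achievable (defect_cost \<theta> \<Lambda> r) 0 (- K)"
proof -
  obtain Y where Y: "Y > 0" "achievable (defect_cost \<theta> \<Lambda> r) (vector [0, - (1 * Y)]) (- K)"
    using achievable_axis[OF assms, of 1] by blast
  obtain Z where Z: "Z > 0" "achievable (defect_cost \<theta> \<Lambda> r) (vector [0, - (-1 * Z)]) (- K)"
    using achievable_axis[OF assms, of "-1"] by blast
  define \<mu> where "\<mu> = Z / (Y + Z)"
  have \<mu>: "0 < \<mu>" "\<mu> < 1" "0 = \<mu> * (- (1 * Y)) + (1 - \<mu>) * (- (- 1 * Z))"
    using Y(1) Z(1) by (auto simp: \<mu>_def field_simps)
  have c: "continuous_on UNIV (defect_cost \<theta> \<Lambda> r)" using assms by (intro continuous_on_defect_cost) simp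
  have "achievable (defect_cost \<theta> \<Lambda> r) (vector [0, 0]) (\<mu> * (- K) + (1 - \<mu>) * (- K))"
    by (rule achievable_split_2[OF c Y(2) Z(2) \<mu>])
  moreover have "(vector [0, 0] :: real^2) = 0" by (simp add: vec_eq_iff forall_2)
  ultimately show ?thesis by (simp add: algebra_simps)
qed

section \<open>Weak derivatives of smooth functions\<close>

definition compactly_supported :: "('a::euclidean_space \<Rightarrow> real) \<Rightarrow> bool" where
  "compactly_supported f \<longleftrightarrow> (\<exists>R. \<forall>x. R < norm x \<longrightarrow> f x = 0)"

lemma compactly_supported_pd:
  assumes "compactly_supported f"
  shows "compactly_supported (pd v f)"
proof -
  obtain R where R: "\<And>x. R < norm x \<Longrightarrow> f x = 0" using assms by (auto simp: compactly_supported_def)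
  have "pd v f x = 0" if "R < norm x" for x
  proof (rule pd_eqI)
    have "open {x::'a. R < norm x}" by (intro open_Collect_less continuous_intros)
    then show "(f has_derivative (\<lambda>_. 0)) (at x)"
      by (rule has_derivative_transform_within_open[OF has_derivative_const[of 0]])
        (use that R in auto)
  qed
  then show ?thesis by (auto simp: compactly_supported_def)
qed

lemma compactly_supported_translate:
  assumes "compactly_supported f"
  shows "compactly_supported (\<lambda>x. f (x + c))"
proof -
  obtain R where R: "\<And>x. R < norm x \<Longrightarrow> f x = 0" using assms by (auto simp: compactly_supported_def)
  have "R < norm (x + c)" if "R + norm c < norm x" for x
    using norm_triangle_ineq4[of "x + c" c] that by simp
  then show ?thesis using R by (auto simp: compactly_supported_def)
qed

lemma compactly_supported_diff:
  assumes "compactly_supported f" "compactly_supported g"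
  shows "compactly_supported (\<lambda>x. f x - g x)"
proof -
  obtain R S where "\<And>x. R < norm x \<Longrightarrow> f x = 0" "\<And>x. S < norm x \<Longrightarrow> g x = 0"
    using assms by (auto simp: compactly_supported_def)
  then have "\<forall>x. max R S < norm x \<longrightarrow> f x - g x = 0" by auto
  then show ?thesis unfolding compactly_supported_def by blast
qed

lemma compactly_supported_mult:
  "compactly_supported f \<Longrightarrow> compactly_supported (\<lambda>x. f x * g x)"
  by (auto simp: compactly_supported_def)

lemma compactly_supported_mult2:
  "compactly_supported f \<Longrightarrow> compactly_supported (\<lambda>x. g x * f x)"
  by (auto simp: compactly_supported_def)

lemma compactly_supported_bounded:
  assumes "compactly_supported f" "continuous_on UNIV f"
  obtains C where "C \<ge> 0" "\<And>x. \<bar>f x\<bar> \<le> C"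
proof -
  obtain R where R: "\<And>x. R < norm x \<Longrightarrow> f x = 0" using assms by (auto simp: compactly_supported_def)
  have "bounded (f ` cball 0 R)"
    by (intro compact_imp_bounded compact_continuous_image continuous_on_subset[OF assms(2)]) auto
  then obtain C where C: "\<And>x. x \<in> cball 0 R \<Longrightarrow> \<bar>f x\<bar> \<le> C"
    unfolding bounded_iff by (metis imageI real_norm_def)
  have "\<bar>f x\<bar> \<le> max C 0" for x
    using C[of x] R[of x] by (cases "R < norm x") (auto intro: max.coboundedI1)
  then show thesis by (intro that[of "max C 0"]) auto
qed

lemma integrable_compactly_supported:
  assumes "compactly_supported f" "continuous_on UNIV f"
  shows "integrable lborel f"
proof -
  obtain R where R: "\<And>x. R < norm x \<Longrightarrow> f x = 0" using assms by (auto simp: compactly_supported_def)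
  have "integrable lborel (\<lambda>x. indicator (cball 0 R) x *\<^sub>R f x)"
    by (intro borel_integrable_compact continuous_on_subset[OF assms(2)]) auto
  moreover have "(\<lambda>x. indicator (cball 0 R) x *\<^sub>R f x) = f"
    using R by (auto simp: indicator_def fun_eq_iff not_le)
  ultimately show ?thesis by simp
qed

section \<open>Difference quotients and integration by parts on the whole space\<close>

lemma lborel_integral_translate:
  fixes f :: "'a::euclidean_space \<Rightarrow> real"
  assumes "f \<in> borel_measurable borel"
  shows "(LINT x|lborel. f (x + c)) = (LINT x|lborel. f x)"
proof -
  have "(LINT x|lborel. f x) = (LINT x|distr lborel borel ((+) c). f x)" by (simp add: lborel_distr_plus)
  also have "\<dots> = (LINT x|lborel. f (c + x))" by (rule integral_distr) (use assms in auto)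
  finally show ?thesis by (simp add: add.commute)
qed

lemma smooth_translate: "smooth f \<Longrightarrow> smooth (\<lambda>x. f (x + c))"
  by (rule smooth_compose_affine[OF bounded_linear_ident])

lemma pd_translate:
  assumes "smooth f" shows "pd v (\<lambda>x. f (x + c)) x = pd v f (x + c)"
  using pd_compose_affine(1)[OF bounded_linear_ident smooth_differentiable[OF assms], of v c x]
  by (simp add: pd_def)

lemma pd_has_derivative_line:
  assumes "smooth f"
  shows "((\<lambda>t. f (x + t *\<^sub>R v)) has_real_derivative pd v f (x + t *\<^sub>R v)) (at t)"
proof -
  have 1: "((\<lambda>t. x + t *\<^sub>R v) has_derivative (\<lambda>h. h *\<^sub>R v)) (at t)"
    by (auto intro!: derivative_eq_intros)
  have d: "f differentiable at (x + t *\<^sub>R v)" by (rule smooth_differentiable[OF assms])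
  have "((\<lambda>t. f (x + t *\<^sub>R v)) has_derivative (\<lambda>h. frechet_derivative f (at (x + t *\<^sub>R v)) (h *\<^sub>R v))) (at t)"
    by (rule has_derivative_compose[OF 1]) (use d frechet_derivative_works in blast)
  moreover have "frechet_derivative f (at (x + t *\<^sub>R v)) (h *\<^sub>R v) = pd v f (x + t *\<^sub>R v) * h" for h
    using linear_frechet_derivative[OF d] by (simp add: linear_scale pd_def)
  ultimately show ?thesis by (simp add: has_field_derivative_def)
qed

text \<open>Dominated convergence: the mean value bound along lines in direction \<open>v\<close>
  gives the majorant C \<bar>\<phi>\<bar>, integrable because \<phi> has compact support.\<close>

lemma difference_quotient_integral:
  fixes h \<phi> :: "'a::euclidean_space \<Rightarrow> real"
  assumes h: "smooth h" "compactly_supported h" and v: "v \<in> Basis"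
    and \<phi>: "compactly_supported \<phi>" "continuous_on UNIV \<phi>"
    and s: "s \<longlonglongrightarrow> 0" "\<And>n. s n \<noteq> 0"
  shows "(\<lambda>n. LINT x|lborel. (h (x + s n *\<^sub>R v) - h x) / s n * \<phi> x) \<longlonglongrightarrow>
      (LINT x|lborel. pd v h x * \<phi> x)"
proof -
  obtain C where C: "C \<ge> 0" "\<And>x. \<bar>pd v h x\<bar> \<le> C"
    by (rule compactly_supported_bounded[OF compactly_supported_pd[OF h(2)] smooth_continuous_on[OF smooth_pd[OF h(1) v]]])
      (rule that, assumption+)
  have lip: "\<bar>(h (x + t *\<^sub>R v) - h x) / t\<bar> \<le> C" if "t \<noteq> 0" for x t
  proof -
    have d: "((\<lambda>t. h (x + t *\<^sub>R v)) has_real_derivative pd v h (x + t *\<^sub>R v)) (at t within UNIV)" for t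
      using pd_has_derivative_line[OF h(1)] by simp
    have "norm ((\<lambda>t. h (x + t *\<^sub>R v)) t - (\<lambda>t. h (x + t *\<^sub>R v)) 0) \<le> C * norm (t - 0)"
      by (rule field_differentiable_bound[OF convex_UNIV d]) (use C in auto)
    then show ?thesis using that by (simp add: abs_divide divide_le_eq)
  qed
  have hb: "h \<in> borel_measurable borel"
    using smooth_continuous_on[OF h(1)] by (rule borel_measurable_continuous_onI)
  have \<phi>b: "\<phi> \<in> borel_measurable borel"
    using \<phi>(2) by (rule borel_measurable_continuous_onI)
  have pb: "pd v h \<in> borel_measurable borel"
    using smooth_continuous_on[OF smooth_pd[OF h(1) v]] by (rule borel_measurable_continuous_onI)
  show ?thesis
  proof (rule integral_dominated_convergence[where w = "\<lambda>x. C * \<bar>\<phi> x\<bar>"])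
    show "(\<lambda>x. pd v h x * \<phi> x) \<in> borel_measurable lborel" using pb \<phi>b by measurable
    show "(\<lambda>x. (h (x + s n *\<^sub>R v) - h x) / s n * \<phi> x) \<in> borel_measurable lborel" for n
      using hb \<phi>b by measurable
    show "integrable lborel (\<lambda>x. C * \<bar>\<phi> x\<bar>)"
      using integrable_compactly_supported[OF \<phi>] by (intro integrable_mult_right integrable_abs)
    show "AE x in lborel. (\<lambda>n. (h (x + s n *\<^sub>R v) - h x) / s n * \<phi> x) \<longlonglongrightarrow> pd v h x * \<phi> x"
    proof (rule AE_I2)
      fix x
      have "((\<lambda>t. (h (x + (0 + t) *\<^sub>R v) - h (x + 0 *\<^sub>R v)) / t) \<longlongrightarrow> pd v h (x + 0 *\<^sub>R v)) (at 0)"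
        using pd_has_derivative_line[OF h(1), of x v 0] unfolding DERIV_def .
      moreover have "filterlim s (at 0) sequentially"
        using s by (auto simp: filterlim_at)
      ultimately have "(\<lambda>n. (h (x + (0 + s n) *\<^sub>R v) - h (x + 0 *\<^sub>R v)) / s n) \<longlonglongrightarrow>
          pd v h (x + 0 *\<^sub>R v)"
        by (rule filterlim_compose)
      then show "(\<lambda>n. (h (x + s n *\<^sub>R v) - h x) / s n * \<phi> x) \<longlonglongrightarrow> pd v h x * \<phi> x"
        by (intro tendsto_mult tendsto_const) simp
    qed
    show "AE x in lborel. norm ((h (x + s n *\<^sub>R v) - h x) / s n * \<phi> x) \<le> C * \<bar>\<phi> x\<bar>" for n
      using lip[OF s(2)] by (intro AE_I2) (simp only: real_norm_def abs_mult, intro mult_right_mono, auto)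
  qed
qed

text \<open>Translation invariance moves the difference quotient with step t from \<open>h\<close>
  to the one of \<phi> with step -t, up to a sign. Passing to the limit on both sides avoids
  iterated integrals.\<close>

lemma integral_by_parts_compact:
  fixes h \<phi> :: "'a::euclidean_space \<Rightarrow> real"
  assumes h: "smooth h" "compactly_supported h" and \<phi>: "smooth \<phi>" "compactly_supported \<phi>" and v: "v \<in> Basis"
  shows "(LINT x|lborel. pd v h x * \<phi> x) = - (LINT x|lborel. h x * pd v \<phi> x)"
proof -
  define s where "s n = inverse (real (Suc n))" for n
  have s: "s \<longlonglongrightarrow> 0" "(\<lambda>n. - s n) \<longlonglongrightarrow>
      0" "\<And>n. s n \<noteq> 0" "\<And>n. - s n \<noteq> 0"
    unfolding s_def using LIMSEQ_inverse_real_of_nat tendsto_minus[OF LIMSEQ_inverse_real_of_nat] by auto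
  note ch = smooth_continuous_on[OF h(1)] and c\<phi> = smooth_continuous_on[OF \<phi>(1)]
  have shift: "(LINT x|lborel. (h (x + t *\<^sub>R v) - h x) / t * \<phi> x) =
      - (LINT x|lborel. (\<phi> (x + (- t) *\<^sub>R v) - \<phi> x) / (- t) * h x)" if "t \<noteq> 0" for t
  proof -
    have i1: "integrable lborel (\<lambda>x. h (x + t *\<^sub>R v) * \<phi> x)"
      by (intro integrable_compactly_supported compactly_supported_mult2 \<phi> continuous_on_mult c\<phi>
          smooth_continuous_on smooth_translate h)
    have i2: "integrable lborel (\<lambda>x. h x * \<phi> x)"
      by (intro integrable_compactly_supported compactly_supported_mult2 \<phi> continuous_on_mult c\<phi> ch)
    have i3: "integrable lborel (\<lambda>x. \<phi> (x + (- t) *\<^sub>R v) * h x)"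
      by (intro integrable_compactly_supported compactly_supported_mult2 h continuous_on_mult ch
          smooth_continuous_on smooth_translate \<phi>)
    have "(LINT x|lborel. \<phi> (x + (- t) *\<^sub>R v) * h x) =
        (LINT x|lborel. \<phi> ((x + t *\<^sub>R v) + (- t) *\<^sub>R v) * h (x + t *\<^sub>R v))"
      by (rule lborel_integral_translate[symmetric]) (use i3 in auto)
    then have e: "(LINT x|lborel. h (x + t *\<^sub>R v) * \<phi> x) = (LINT x|lborel. \<phi> (x + (- t) *\<^sub>R v) * h x)"
      by (simp add: mult.commute)
    have "(LINT x|lborel. (h (x + t *\<^sub>R v) - h x) / t * \<phi> x) =
        (LINT x|lborel. (h (x + t *\<^sub>R v) * \<phi> x - h x * \<phi> x) / t)"
      by (intro Bochner_Integration.integral_cong) (auto simp: field_simps)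
    also have "\<dots> = ((LINT x|lborel. \<phi> (x + (- t) *\<^sub>R v) * h x) - (LINT x|lborel. h x * \<phi> x)) / t"
      using i1 i2 e by simp
    also have "\<dots> = (LINT x|lborel. (\<phi> (x + (- t) *\<^sub>R v) * h x - h x * \<phi> x) / t)"
      using i3 i2 by simp
    also have "\<dots> = (LINT x|lborel. - ((\<phi> (x + (- t) *\<^sub>R v) - \<phi> x) / (- t) * h x))"
      by (intro Bochner_Integration.integral_cong) (auto simp: field_simps)
    finally show ?thesis by simp
  qed
  have "(\<lambda>n. LINT x|lborel. (h (x + s n *\<^sub>R v) - h x) / s n * \<phi> x) \<longlonglongrightarrow>
      (LINT x|lborel. pd v h x * \<phi> x)"
    by (rule difference_quotient_integral[OF h v \<phi>(2) c\<phi> s(1,3)])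
  moreover have "(\<lambda>n. - (LINT x|lborel. (\<phi> (x + (- s n) *\<^sub>R v) - \<phi> x) / (- s n) * h x)) \<longlonglongrightarrow>
      - (LINT x|lborel. pd v \<phi> x * h x)"
    by (intro tendsto_minus difference_quotient_integral[OF \<phi> v h(2) ch s(2,4)])
  ultimately have "(LINT x|lborel. pd v h x * \<phi> x) = - (LINT x|lborel. pd v \<phi> x * h x)"
    unfolding shift[OF s(3)] by (rule LIMSEQ_unique)
  then show ?thesis by (simp add: mult.commute)
qed

text \<open>Difference quotients in direction \<open>v\<close> replace the symmetry of second derivatives.\<close>

lemma integral_pd_swap:
  fixes h \<phi> :: "'a::euclidean_space \<Rightarrow> real"
  assumes h: "smooth h" "compactly_supported h" and \<phi>: "smooth \<phi>" "compactly_supported \<phi>"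
    and v: "v \<in> Basis" and w: "w \<in> Basis"
  shows "(LINT x|lborel. pd v h x * pd w \<phi> x) = (LINT x|lborel. pd w h x * pd v \<phi> x)"
proof -
  define s where "s n = inverse (real (Suc n))" for n
  have s: "s \<longlonglongrightarrow> 0" "\<And>n. s n \<noteq> 0"
    unfolding s_def using LIMSEQ_inverse_real_of_nat by auto
  have sk: "smooth (pd w h)" and ck: "compactly_supported (pd w h)"
    using h w smooth_pd compactly_supported_pd by auto
  have eq: "(LINT x|lborel. (h (x + t *\<^sub>R v) - h x) / t * pd w \<phi> x) =
      - (LINT x|lborel. (pd w h (x + t *\<^sub>R v) - pd w h x) / t * \<phi> x)" if "t \<noteq> 0" for t
  proof -
    \<comment> \<open>The quotient is again smooth with compact support, and \<open>pd w\<close>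
      commutes with it since it combines translates linearly; so integration by parts in direction
      \<open>w\<close> applies before the limit in direction \<open>v\<close>.\<close>
    define q where "q x = 1 / t * h (x + t *\<^sub>R v) + - 1 / t * h x" for x
    have sq: "smooth q" unfolding q_def[abs_def]
      by (intro smooth_add smooth_mult smooth_const smooth_translate h)
    have q: "q x = (h (x + t *\<^sub>R v) - h x) / t" for x by (simp add: q_def diff_divide_distrib)
    have "compactly_supported (\<lambda>x. 1 / t * (h (x + t *\<^sub>R v) - h x))"
      by (intro compactly_supported_mult2 compactly_supported_diff compactly_supported_translate h)
    then have cq: "compactly_supported q" by (simp add: q[abs_def])
    have c: "pd w (\<lambda>x. c * f x) x = c * pd w f x" if "smooth f" for c f and x :: 'a
      using pd_mult[OF smooth_differentiable[OF smooth_const] smooth_differentiable[OF that], of w c x]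
      by (simp add: pd_eqI[where f'="\<lambda>_. 0"])
    have "pd w q x = (pd w h (x + t *\<^sub>R v) - pd w h x) / t" for x
    proof -
      have "pd w q x = pd w (\<lambda>x. 1 / t * h (x + t *\<^sub>R v)) x + pd w (\<lambda>x. - 1 / t * h x) x"
        unfolding q_def[abs_def]
        by (intro pd_add smooth_differentiable smooth_mult smooth_const smooth_translate h)
      also have "\<dots> = 1 / t * pd w h (x + t *\<^sub>R v) + - 1 / t * pd w h x"
        by (simp only: c[OF h(1)] c[OF smooth_translate[OF h(1)]] pd_translate[OF h(1)])
      finally show ?thesis by (simp add: diff_divide_distrib)
    qed
    then show ?thesis
      using integral_by_parts_compact[OF sq cq \<phi> w] by (simp add: q)
  qed
  have l1: "(\<lambda>n. LINT x|lborel. (h (x + s n *\<^sub>R v) - h x) / s n * pd w \<phi> x) \<longlonglongrightarrow>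
      (LINT x|lborel. pd v h x * pd w \<phi> x)"
    by (rule difference_quotient_integral[OF h v _ _ s])
      (use \<phi> w in \<open>auto intro!: compactly_supported_pd smooth_continuous_on smooth_pd\<close>)
  have l2: "(\<lambda>n. - (LINT x|lborel. (pd w h (x + s n *\<^sub>R v) - pd w h x) / s n * \<phi> x)) \<longlonglongrightarrow>
      - (LINT x|lborel. pd v (pd w h) x * \<phi> x)"
    by (intro tendsto_minus difference_quotient_integral[OF sk ck v \<phi>(2) smooth_continuous_on[OF \<phi>(1)] s])
  have l3: "- (LINT x|lborel. pd v (pd w h) x * \<phi> x) = (LINT x|lborel. pd w h x * pd v \<phi> x)"
    using integral_by_parts_compact[OF sk ck \<phi> v] by simp
  show ?thesis
    by (rule trans[OF LIMSEQ_unique[OF l1[unfolded eq[OF s(2)]] l2] l3])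
qed

section \<open>Test functions, weak gradients and Sobolev membership\<close>

lemma grad_eq_pd: "grad f x = (\<Sum>b\<in>Basis. pd b f x *\<^sub>R b)"
  by (simp add: grad_def pd_def)

lemma grad_inner_Basis: "b \<in> Basis \<Longrightarrow> grad f x \<bullet> b = pd b f x"
  by (simp add: grad_eq_pd inner_sum_left inner_Basis if_distrib sum.delta cong: if_cong)

lemma grad_nth: "grad f x $ i = D i f (x :: real^'n::finite)"
proof -
  have "axis i (1::real) \<in> Basis" by (auto simp: axis_in_Basis_iff)
  from grad_inner_Basis[OF this, of f x] show ?thesis by (simp add: inner_axis)
qed

lemma continuous_on_grad: "smooth f \<Longrightarrow> continuous_on S (grad f)"
  unfolding grad_eq_pd[abs_def] by (intro continuous_intros smooth_continuous_on smooth_pd)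

lemma grad_eq_0_off_support:
  assumes "x \<notin> closure {x. f x \<noteq> 0}"
  shows "pd v f x = 0" "grad f x = 0"
proof -
  have "pd v f x = 0" for v
  proof (rule pd_eqI)
    show "(f has_derivative (\<lambda>_. 0)) (at x)"
    proof (rule has_derivative_transform_within_open[of "\<lambda>_. 0" _ _ _ "- closure {x. f x \<noteq> 0}"])
      show "0 = f y" if "y \<in> - closure {x. f x \<noteq> 0}" for y
        using that closure_subset[of "{x. f x \<noteq> 0}"] by auto
      show "x \<in> - closure {x. f x \<noteq> 0}" using assms by simp
      show "open (- closure {x. f x \<noteq> 0})" by (rule open_Compl[OF closed_closure])
    qed (rule has_derivative_const)
  qed
  then show "pd v f x = 0" "grad f x = 0" by (simp_all add: grad_eq_pd)
qed

lemma test_functionsD: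
  assumes "\<phi> \<in> test_functions \<Omega>"
  shows "smooth \<phi>" "compactly_supported \<phi>" "x \<notin> \<Omega> \<Longrightarrow> \<phi> x =
      0" "x \<notin> \<Omega> \<Longrightarrow> pd v \<phi> x = 0" "x \<notin> \<Omega> \<Longrightarrow> grad \<phi> x = 0"
proof -
  define S where "S = closure {x. \<phi> x \<noteq> 0}"
  have S: "compact S" "S \<subseteq> \<Omega>" using assms by (auto simp: test_functions_def S_def)
  show "smooth \<phi>" using assms by (simp add: test_functions_def smooth_def)
  obtain R where R: "\<And>x. x \<in> S \<Longrightarrow> norm x \<le> R"
    using compact_imp_bounded[OF S(1)] unfolding bounded_iff by blast
  have sub: "\<phi> x = 0" if "x \<notin> S" for x
    using that closure_subset[of "{x. \<phi> x \<noteq> 0}"] by (auto simp: S_def)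
  have "\<phi> x = 0" if "R < norm x" for x
    by (rule sub) (use R[of x] that in auto)
  then show "compactly_supported \<phi>" unfolding compactly_supported_def by blast
  show "\<phi> x = 0" if "x \<notin> \<Omega>"
    by (rule sub) (use S(2) that in blast)
  have n: "x \<notin> closure {x. \<phi> x \<noteq> 0}" if "x \<notin> \<Omega>" using S(2) that unfolding S_def by blast
  show "pd v \<phi> x = 0" if "x \<notin> \<Omega>" by (rule grad_eq_0_off_support(1)[OF n[OF that]])
  show "grad \<phi> x = 0" if "x \<notin> \<Omega>" by (rule grad_eq_0_off_support(2)[OF n[OF that]])
qed

lemma test_functionsI:
  assumes "smooth f" "\<And>x. x \<notin> K \<Longrightarrow> f x = 0" "compact K" "K \<subseteq> \<Omega>"
  shows "f \<in> test_functions \<Omega>"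
proof -
  have "closed K" using assms(3) by (rule compact_imp_closed)
  then have sub: "closure {x. f x \<noteq> 0} \<subseteq> K"
    using assms(2) by (intro closure_minimal) auto
  have "compact (K \<inter> closure {x. f x \<noteq> 0})"
    by (rule compact_Int_closed[OF assms(3) closed_closure])
  then have "compact (closure {x. f x \<noteq> 0})"
    unfolding Int_absorb1[OF sub] .
  then show ?thesis using assms(1,4) sub by (auto simp: test_functions_def smooth_def)
qed

lemma borel_measurable_lebesgue_on_continuous:
  fixes f :: "'a::euclidean_space \<Rightarrow> 'b::euclidean_space"
  assumes "continuous_on UNIV f"
  shows "f \<in> borel_measurable (lebesgue_on \<Omega>)"
  using borel_measurable_continuous_onI[OF assms]
  by (intro measurable_restrict_space1) (simp add: measurable_completion)

lemma integral_lebesgue_on_eq_lborel: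
  fixes f :: "'a::euclidean_space \<Rightarrow> 'b::euclidean_space"
  assumes "continuous_on UNIV f" "\<And>x. x \<notin> \<Omega> \<Longrightarrow> f x = 0" "\<Omega> \<in> sets lebesgue"
  shows "(LINT x|lebesgue_on \<Omega>. f x) = (LINT x|lborel. f x)"
proof -
  have "(LINT x|lebesgue_on \<Omega>. f x) = (LINT x|lebesgue. indicator \<Omega> x *\<^sub>R f x)"
    using assms(3) by (intro integral_restrict_space) auto
  also have "(\<lambda>x. indicator \<Omega> x *\<^sub>R f x) = f"
    using assms(2) by (auto simp: indicator_def fun_eq_iff)
  also have "(LINT x|lebesgue. f x) = (LINT x|lborel. f x)"
    using borel_measurable_continuous_onI[OF assms(1)] by (intro integral_completion) simp
  finally show ?thesis .
qed

lemma continuous_integrable_lebesgue_on: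
  fixes f :: "'a::euclidean_space \<Rightarrow> 'b::euclidean_space"
  assumes f: "continuous_on UNIV f" and "bounded S" "S \<in> sets lebesgue"
  shows "integrable (lebesgue_on S) f"
proof -
  obtain R where "\<forall>x\<in>S. norm x \<le> R" using assms(2) unfolding bounded_iff by blast
  then have R: "S \<subseteq> cball 0 R" by auto
  have "bounded (f ` cball 0 R)"
    by (intro compact_imp_bounded compact_continuous_image continuous_on_subset[OF f]) auto
  then obtain B where "\<forall>y\<in>f ` cball 0 R. norm y \<le> B"
    unfolding bounded_iff by blast
  then have B: "norm (f x) \<le> B" if "x \<in> cball 0 R" for x
    using that by simp
  have "emeasure lebesgue S \<le> emeasure lebesgue (cball 0 R :: 'a set)" by (rule emeasure_mono[OF R]) simp
  also have "\<dots> = emeasure lborel (cball 0 R :: 'a set)" by simp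
  also have "\<dots> < \<infinity>" using emeasure_lborel_cball_finite by simp
  finally have "emeasure lebesgue S < \<infinity>" .
  then have "finite_measure (lebesgue_on S)"
    using assms(3) by (intro finite_measureI) (simp add: emeasure_restrict_space space_restrict_space)
  then show ?thesis
    using R by (intro finite_measure.integrable_const_bound[where B=B] borel_measurable_lebesgue_on_continuous[OF f] AE_I2 B)
      (auto simp: space_restrict_space)
qed

lemma continuous_locally_integrable:
  assumes "continuous_on UNIV f"
  shows "locally_integrable \<Omega> f"
  unfolding locally_integrable_def
proof (intro allI impI)
  fix K assume K: "compact K \<and> K \<subseteq> \<Omega>"
  then have "integrable (lebesgue_on K) f"
    by (intro continuous_integrable_lebesgue_on assms compact_imp_bounded) (auto simp: lmeasurable_compact fmeasurableD)
  then show "f absolutely_integrable_on K"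
    using K integrable_restrict_space[of K lebesgue f] by (simp add: set_integrable_def lmeasurable_compact fmeasurableD)
qed

text \<open>A test function and its gradient vanish off \<Omega>, so both integrals extend to the
  whole space, where integration by parts holds in each coordinate.\<close>

lemma smooth_has_weak_gradient:
  fixes u :: "'a::euclidean_space \<Rightarrow> real"
  assumes u: "smooth u" "compactly_supported u" and \<Omega>: "\<Omega> \<in> sets lebesgue"
  shows "has_weak_gradient \<Omega> u (grad u)"
  unfolding has_weak_gradient_def
proof (intro conjI ballI)
  note cu = smooth_continuous_on[OF u(1)] and cg = continuous_on_grad[OF u(1)]
  show "locally_integrable \<Omega> u" "locally_integrable \<Omega> (grad u)"
    by (intro continuous_locally_integrable cu cg)+
  fix \<phi> assume p: "\<phi> \<in> test_functions \<Omega>"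
  note \<phi> = test_functionsD[OF p]
  note c\<phi> = smooth_continuous_on[OF \<phi>(1)] and cg\<phi> = continuous_on_grad[OF \<phi>(1)]
  have ig: "integrable lborel (\<lambda>x. f x *\<^sub>R grad g x)"
    if "smooth f" "smooth g" "compactly_supported f \<or> compactly_supported g" for f g :: "'a \<Rightarrow> real"
  proof -
    have "integrable lborel (\<lambda>x. f x * pd b g x)" if "b \<in> Basis" for b
    proof (rule integrable_compactly_supported)
      show "compactly_supported (\<lambda>x. f x * pd b g x)"
        using \<open>compactly_supported f \<or> compactly_supported g\<close>
      proof
        assume "compactly_supported g"
        then show ?thesis by (intro compactly_supported_mult2 compactly_supported_pd)
      qed (rule compactly_supported_mult)
      show "continuous_on UNIV (\<lambda>x. f x * pd b g x)"
        by (intro continuous_on_mult smooth_continuous_on[OF \<open>smooth f\<close>] smooth_continuous_on[OF smooth_pd[OF \<open>smooth g\<close> that]])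
    qed
    then have "integrable lborel (\<lambda>x. \<Sum>b\<in>Basis. (f x * pd b g x) *\<^sub>R b)"
      by (intro Bochner_Integration.integrable_sum integrable_scaleR_left) auto
    then show ?thesis by (simp add: grad_eq_pd scaleR_sum_right)
  qed
  note i1 = ig[OF u(1) \<phi>(1) disjI1[OF u(2)]] and i2 = ig[OF \<phi>(1) u(1) disjI2[OF u(2)]]
  have "(LINT x|lborel. u x *\<^sub>R grad \<phi> x) = - (LINT x|lborel. \<phi> x *\<^sub>R grad u x)"
  proof (rule euclidean_eqI)
    fix b :: 'a assume b: "b \<in> Basis"
    have "(LINT x|lborel. u x *\<^sub>R grad \<phi> x) \<bullet> b = (LINT x|lborel. u x * pd b \<phi> x)"
      using integral_inner_left[OF i1, of b] b by (simp add: grad_inner_Basis)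
    also have "\<dots> = - (LINT x|lborel. pd b u x * \<phi> x)"
      using integral_by_parts_compact[OF u \<phi>(1,2) b] by simp
    also have "(LINT x|lborel. pd b u x * \<phi> x) = (LINT x|lborel. \<phi> x *\<^sub>R grad u x) \<bullet> b"
      using integral_inner_left[OF i2, of b] b by (simp add: grad_inner_Basis mult.commute)
    finally show "(LINT x|lborel. u x *\<^sub>R grad \<phi> x) \<bullet> b =
        - (LINT x|lborel. \<phi> x *\<^sub>R grad u x) \<bullet> b" by simp
  qed
  moreover have "(LINT x|lebesgue_on \<Omega>. u x *\<^sub>R grad \<phi> x) = (LINT x|lborel. u x *\<^sub>R grad \<phi> x)"
    using \<phi>(5) by (intro integral_lebesgue_on_eq_lborel \<Omega> continuous_on_scaleR cu cg\<phi>) auto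
  moreover have "(LINT x|lebesgue_on \<Omega>. \<phi> x *\<^sub>R grad u x) = (LINT x|lborel. \<phi> x *\<^sub>R grad u x)"
    using \<phi>(3) by (intro integral_lebesgue_on_eq_lborel \<Omega> continuous_on_scaleR c\<phi> cg) auto
  ultimately show "(LINT x|lebesgue_on \<Omega>. u x *\<^sub>R grad \<phi> x) =
      - (LINT x|lebesgue_on \<Omega>. \<phi> x *\<^sub>R grad u x)" by simp
qed

lemma continuous_bounded_L_infty:
  fixes f :: "'a::euclidean_space \<Rightarrow> 'b::euclidean_space"
  assumes "continuous_on UNIV f" "\<And>x. x \<in> \<Omega> \<Longrightarrow> norm (f x) \<le> M"
  shows "f \<in> L_infty \<Omega>"
  unfolding L_infty_def mem_Collect_eq
proof (intro conjI exI[of _ M] AE_I2)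
  show "f \<in> borel_measurable (lebesgue_on \<Omega>)" by (rule borel_measurable_lebesgue_on_continuous[OF assms(1)])
  show "norm (f x) \<le> M" if "x \<in> space (lebesgue_on \<Omega>)" for x
    using that assms(2) by (simp add: space_restrict_space)
qed

lemma continuous_L_infty:
  fixes f :: "'a::euclidean_space \<Rightarrow> 'b::euclidean_space"
  assumes "continuous_on UNIV f" "bounded \<Omega>"
  shows "f \<in> L_infty \<Omega>"
proof -
  obtain R where "\<forall>x\<in>\<Omega>. norm x \<le> R" using assms(2) unfolding bounded_iff by blast
  then have R: "\<Omega> \<subseteq> cball 0 R" by auto
  have "bounded (f ` cball 0 R)"
    by (intro compact_imp_bounded compact_continuous_image continuous_on_subset[OF assms(1)]) auto
  then obtain B where "\<forall>y\<in>f ` cball 0 R. norm y \<le> B"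
    unfolding bounded_iff by blast
  then have B: "norm (f x) \<le> B" if "x \<in> cball 0 R" for x
    using that by simp
  with R show ?thesis by (intro continuous_bounded_L_infty[OF assms(1), of _ B]) auto
qed

text \<open>The constant sequence \<open>u\<close> is its own approximation in the
  \<open>W1_1_0\<close> part; the bounds come from continuity on a bounded set.\<close>

lemma test_function_W1_infty_0:
  assumes u: "u \<in> test_functions \<Omega>" and \<Omega>: "bounded \<Omega>" "\<Omega> \<in> sets lebesgue"
  shows "u \<in> W1_infty_0 \<Omega>"
proof -
  note U = test_functionsD[OF u]
  note cu = smooth_continuous_on[OF U(1)] and cg = continuous_on_grad[OF U(1)]
  note wg = smooth_has_weak_gradient[OF U(1,2) \<Omega>(2)]
  have "u \<in> W1_infty \<Omega>"
    unfolding W1_infty_def mem_Collect_eq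
    by (intro conjI bexI[of _ "grad u"] wg continuous_L_infty cu cg \<Omega>(1))
  moreover have "u \<in> W1_1_0 \<Omega>"
    unfolding W1_1_0_def mem_Collect_eq
  proof (intro conjI exI[of _ "grad u"] exI[of _ "\<lambda>_. u"] allI)
    show "integrable (lebesgue_on \<Omega>) u" "integrable (lebesgue_on \<Omega>) (grad u)"
      by (intro continuous_integrable_lebesgue_on cu cg \<Omega>)+
  qed (use wg u in auto)
  ultimately show ?thesis by (simp add: W1_infty_0_def)
qed

lemma smooth_compactly_supported_lipschitz:
  fixes u :: "'a::euclidean_space \<Rightarrow> real"
  assumes "smooth u" "compactly_supported u"
  obtains C where "C-lipschitz_on S u"
proof -
  have "\<exists>C. C \<ge> 0 \<and> (\<forall>x. \<bar>pd b u x\<bar> \<le> C)" if "b \<in> Basis" for b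
    by (rule compactly_supported_bounded[OF compactly_supported_pd[OF assms(2)] smooth_continuous_on[OF smooth_pd[OF assms(1) that]]])
      blast
  then have "\<forall>b\<in>Basis. \<exists>C. C \<ge> 0 \<and> (\<forall>x. \<bar>pd b u x\<bar> \<le> C)" by blast
  from bchoice[OF this] obtain C where C: "\<And>b. b \<in> Basis \<Longrightarrow>
      C b \<ge> 0" "\<And>b x. b \<in> Basis \<Longrightarrow> \<bar>pd b u x\<bar> \<le> C b"
    by blast
  define B where "B = (\<Sum>b\<in>Basis. C b)"
  have d: "(u has_derivative frechet_derivative u (at x)) (at x within UNIV)" for x
    using smooth_differentiable[OF assms(1)] frechet_derivative_works by auto
  have on: "onorm (frechet_derivative u (at x)) \<le> B" for x
  proof (rule onorm_le)
    fix v
    have "norm (frechet_derivative u (at x) v) \<le> (\<Sum>b\<in>Basis. \<bar>(v \<bullet> b) * pd b u x\<bar>)"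
      unfolding frechet_derivative_eq_sum_pd[OF smooth_differentiable[OF assms(1)]] real_norm_def by (rule sum_abs)
    also have "\<dots> \<le> (\<Sum>b\<in>Basis. norm v * C b)"
      unfolding abs_mult using C by (intro sum_mono mult_mono Basis_le_norm) auto
    also have "\<dots> = B * norm v" unfolding B_def sum_distrib_right by (simp add: mult.commute)
    finally show "norm (frechet_derivative u (at x) v) \<le> B * norm v" .
  qed
  have "B-lipschitz_on S u"
  proof (rule lipschitz_onI)
    show "dist (u x) (u y) \<le> B * dist x y" for x y
      using differentiable_bound[OF convex_UNIV d on, of x y] by (simp add: dist_norm)
    show "0 \<le> B" unfolding B_def using C by (intro sum_nonneg) auto
  qed
  then show thesis using that by blast
qed

section \<open>The counterexample\<close>

lemma A_field_eq: "A_field \<theta> \<eta> = (\<chi> i. flux \<theta> (\<eta> $ i))"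
  by (simp add: A_field_def flux_def vec_eq_iff forall_2 matrix_vector_mult_def sum_2)

lemma powr_add_le:
  fixes a b :: real
  assumes "a \<ge> 0" "b \<ge> 0" "r > 0"
  shows "(a + b) powr r \<le> 2 powr r * a powr r + 2 powr r * b powr r"
proof -
  have "(a + b) powr r \<le> (2 * max a b) powr r" using assms by (intro powr_mono2) auto
  also have "\<dots> = 2 powr r * max a b powr r" using assms by (simp add: powr_mult)
  also have "\<dots> \<le> 2 powr r * (a powr r + b powr r)" by (intro mult_left_mono) (auto simp: max_def)
  finally show ?thesis by (simp add: distrib_left)
qed

theorem theorem1p2:
  fixes \<theta> \<Lambda> r :: real
  assumes "0 < \<theta>" and "\<theta> < 1"
    and "\<Lambda> > 0"
    and "1 < r" and "r < q_bar \<theta>"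
  shows "\<exists>(u :: real^2 \<Rightarrow> real) (Du :: real^2 \<Rightarrow> real^2) (F :: real^2 \<Rightarrow> real^2).
           (\<exists>C. C-lipschitz_on (cball 0 1) u) \<and>
           u \<in> W1_infty_0 (ball 0 1) \<and>
           has_weak_gradient (ball 0 1) u Du \<and>
           F \<in> L_infty (ball 0 1) \<and>
           (\<forall>\<phi>\<in>test_functions (ball 0 1).
              distr_div (ball 0 1) (\<lambda>x. A_field \<theta> (Du x)) \<phi> = distr_div (ball 0 1) F \<phi>) \<and>
           (\<forall>x\<in>sphere 0 1. u x = 0) \<and>
           (LINT x|lebesgue_on (ball 0 1). norm (Du x) powr r)
             > \<Lambda> * (1 + (LINT x|lebesgue_on (ball 0 1). norm (F x) powr r))"
proof -
  let ?B = "ball 0 1 :: (real^2) set"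
  define f where "f L = 1 - 1 / (1 + real L) + 1 / (1 + real L * (1 - \<theta>))" for L
  have "(2::nat) \<in> {L. even L \<and> L \<ge> 2}" by simp
  then have ne: "f ` {L. even L \<and> L \<ge> 2} \<noteq> {}" by blast
  have "r < Sup (f ` {L. even L \<and> L \<ge> 2})" using assms(5) by (simp add: q_bar_def f_def)
  then obtain y where "y \<in> f ` {L. even L \<and> L \<ge> 2}" "r < y" using less_cSupE[OF _ ne] by blast
  then obtain L where L: "L \<ge> 2" "r < 1 - 1 / (1 + real L) + 1 / (1 + real L * (1 - \<theta>))"
    unfolding f_def by blast
  \<comment> \<open>Identifies the member of the supremum that exceeds \<open>r\<close> with the
    decay exponent of the staircase.\<close>
  have "real L / (1 + real L) = 1 - 1 / (1 + real L)" by (simp add: field_simps)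
  then have rL: "r < real L / (1 + real L) + 1 / (1 + real L * (1 - \<theta>))" using L(2) by simp
  \<comment> \<open>The second component of F is at most 3, so norm F \<le> \<bar>F_1\<bar> + 3.
    Splitting the r-th power of this sum costs the factor 2^r, which \<Lambda>' anticipates, and
    leaves the constant \<open>c\<close>.\<close>
  define c where "c = (LINT x|lebesgue_on ?B. 2 powr r * 3 powr r)"
  define \<Lambda>' where "\<Lambda>' = \<Lambda> * 2 powr r"
  have \<Lambda>': "\<Lambda>' > 0" using assms(3) by (simp add: \<Lambda>'_def)
  define g where "g = defect_cost \<theta> \<Lambda>' r"
  \<comment> \<open>Of the 2, one unit is spent on taking \<epsilon> = 1 below, and the other makes
    the final inequality strict.\<close>
  have "achievable g 0 (- (\<Lambda> + \<Lambda> * c + 2))"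
    unfolding g_def by (rule achievable_origin[OF assms(1,2) \<Lambda>' assms(4) _ rL]) (use L in auto)
  then obtain \<Phi> where \<Phi>: "admissible \<Phi> (\<lambda>_. 1)" "cost g 0 \<Phi> \<le> - (\<Lambda> + \<Lambda> * c + 2) + 1"
    unfolding achievable_def achievable_with_def by (meson zero_less_one)
  have s\<Phi>: "smooth (\<Phi> k)" and z\<Phi>: "x \<notin> cbox 0 1 \<Longrightarrow> \<Phi> k x = 0"
    and off: "l \<noteq> k \<Longrightarrow> \<bar>D l (\<Phi> k) x\<bar> \<le> 1" for k l x
    using \<Phi>(1) by (auto simp: admissible_def)
  \<comment> \<open>Centres the unit square at the origin; its half-diagonal, the square root of
    1/2, is less than 1, so it fits into the ball.\<close>
  define p where "p = (\<chi> k::2. (1 / 2 :: real))"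
  define w where "w k x = \<Phi> k (x + p)" for k x
  have sw: "smooth (w k)" for k unfolding w_def[abs_def] by (rule smooth_translate[OF s\<Phi>])
  have Dw: "D l (w k) x = D l (\<Phi> k) (x + p)" for k l x
    unfolding w_def[abs_def] by (rule pd_translate[OF s\<Phi>])
  have box: "x + p \<in> cbox 0 1 \<longleftrightarrow> x \<in> cbox (- p) p" for x
    by (simp add: mem_box_cart forall_2 p_def) linarith
  have boxB: "cbox (- p) p \<subseteq> ?B"
  proof
    fix x assume "x \<in> cbox (- p) p"
    then have "- (1 / 2) \<le> x $ k \<and> x $ k \<le> 1 / 2" for k unfolding mem_box_cart p_def by simp
    then have "\<bar>x $ k\<bar> \<le> 1 / 2" for k using abs_le_iff minus_le_iff by blast
    then have "(x $ k)\<^sup>2 \<le> (1 / 2)\<^sup>2" for k using abs_le_square_iff[of "x $ k" "1 / 2"] by simp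
    from this[of 1] this[of 2] have "(x $ 1)\<^sup>2 + (x $ 2)\<^sup>2 < 1" by (simp add: power_divide)
    moreover have "(norm x)\<^sup>2 = (x $ 1)\<^sup>2 + (x $ 2)\<^sup>2"
      unfolding power2_norm_eq_inner by (simp add: inner_vec_def sum_2 power2_eq_square)
    ultimately have "(norm x)\<^sup>2 < 1" by simp
    then show "x \<in> ?B" by (simp add: abs_square_less_1)
  qed
  have wt: "w k \<in> test_functions ?B" for k
    by (rule test_functionsI[OF sw _ compact_cbox boxB]) (use z\<Phi> box in \<open>simp add: w_def\<close>)
  note W = test_functionsD[OF wt]
  note cD = smooth_continuous_on[OF smooth_D[OF sw], of UNIV]
  have B: "bounded ?B" "?B \<in> sets lebesgue" by auto
  define F :: "real^2 \<Rightarrow> real^2" where "F x = (\<chi> i. if i =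
      1 then flux \<theta> (D 1 (w 1) x) - D 2 (w 2) x else flux \<theta> (D 2 (w 1) x) + D 1 (w 2) x)"
    for x :: "real^2"
  \<comment> \<open>The rotated gradient of the stream function \<open>w 2\<close>; its divergence
    vanishes by \<open>integral_pd_swap\<close>.\<close>
  define J :: "real^2 \<Rightarrow> real^2" where "J x = (\<chi> i. if i = 1 then D 2 (w 2) x else - D 1 (w 2) x)" for x :: "real^2"
  have cflux: "continuous_on UNIV (flux \<theta>)" unfolding flux_def[abs_def] by (intro continuous_intros)
  have cF: "continuous_on UNIV F" unfolding F_def[abs_def]
  proof (rule continuous_on_vec_lambda, goal_cases)
    case (1 i)
    show ?case
      by (cases "i = 1") (auto intro!: continuous_intros cD continuous_on_compose2[OF cflux])
  qed
  have cJ: "continuous_on UNIV J" unfolding J_def[abs_def]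
  proof (rule continuous_on_vec_lambda, goal_cases)
    case (1 i)
    show ?case
      by (cases "i = 1") (auto intro!: continuous_intros cD)
  qed
  have AFJ: "A_field \<theta> (grad (w 1) x) = F x + J x" for x
    by (simp add: A_field_eq F_def J_def vec_eq_iff forall_2 grad_nth)
  have div: "distr_div ?B (\<lambda>x. A_field \<theta> (grad (w 1) x)) \<phi> =
      distr_div ?B F \<phi>" if "\<phi> \<in> test_functions ?B" for \<phi>
  proof -
    note \<phi> = test_functionsD[OF that]
    note cg = continuous_on_grad[OF \<phi>(1), of UNIV]
    have axes: "axis 1 (1::real) \<in> (Basis :: (real^2) set)" "axis 2 (1::real) \<in> (Basis :: (real^2) set)"
      by (auto simp: axis_in_Basis_iff)
    have i: "integrable lborel (\<lambda>x. D k (w 2) x * D l \<phi> x)" for k l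
      by (intro integrable_compactly_supported continuous_on_mult smooth_continuous_on smooth_D sw \<phi>
          compactly_supported_mult compactly_supported_pd W)
    have "(LINT x|lebesgue_on ?B. J x \<bullet> grad \<phi> x) = (LINT x|lborel. J x \<bullet> grad \<phi> x)"
      using \<phi>(5) by (intro integral_lebesgue_on_eq_lborel continuous_intros cJ cg B) auto
    also have "\<dots> = (LINT x|lborel. D 2 (w 2) x * D 1 \<phi> x - D 1 (w 2) x * D 2 \<phi> x)"
      by (simp add: J_def inner_vec_def sum_2 grad_nth)
    also have "\<dots> = 0"
      using integral_pd_swap[OF sw W(2) \<phi>(1,2) axes(2,1), of 2] i by simp
    finally have J0: "(LINT x|lebesgue_on ?B. J x \<bullet> grad \<phi> x) = 0" .
    have "(LINT x|lebesgue_on ?B. A_field \<theta> (grad (w 1) x) \<bullet> grad \<phi> x) =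
       (LINT x|lebesgue_on ?B. F x \<bullet> grad \<phi> x + J x \<bullet> grad \<phi> x)"
      by (simp add: AFJ inner_add_left)
    also have "\<dots> = (LINT x|lebesgue_on ?B. F x \<bullet> grad \<phi> x) + (LINT x|lebesgue_on ?B. J x \<bullet> grad \<phi> x)"
      by (intro Bochner_Integration.integral_add continuous_integrable_lebesgue_on B continuous_intros cF cJ cg)
    finally show ?thesis by (simp add: distr_div_def J0)
  qed
  have rpos: "r > 0" using assms by simp
  have cp: "continuous_on UNIV (\<lambda>x. \<bar>f x\<bar> powr r)" if "continuous_on UNIV f" for f :: "real^2 \<Rightarrow> real"
    using that rpos by (intro continuous_on_powr' continuous_intros) auto
  have intp: "integrable (lebesgue_on ?B) (\<lambda>x. \<bar>f x\<bar> powr r)" if "continuous_on UNIV f" for f :: "real^2 \<Rightarrow> real"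
    by (intro continuous_integrable_lebesgue_on B cp that)
  have cF1: "continuous_on UNIV (\<lambda>x. F x $ 1)" by (intro continuous_intros cF)
  have cost_eq: "(LINT x|lebesgue_on ?B. \<Lambda>' * \<bar>F x $ 1\<bar> powr r - \<bar>D 1 (w 1) x\<bar> powr r) = cost g 0 \<Phi>"
  proof -
    define H where "H y = g (0 + diag_grad \<Phi> y)" for y
    have cg: "continuous_on UNIV g" unfolding g_def by (rule continuous_on_defect_cost[OF rpos])
    have cH: "continuous_on UNIV H" unfolding H_def by (rule continuous_on_cost_integrand[OF cg s\<Phi>])
    \<comment> \<open>The cost is 0 at the origin, so the integral over the ball, over the plane and
      over the unit square agree.\<close>
    have H0: "H y = 0" if "y \<notin> cbox 0 1" for y
    proof -
      have "y \<notin> box 0 1" using that box_subset_cbox by blast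
      then have "D k (\<Phi> k) y = 0" for k using D_eq_0_outside[OF s\<Phi> z\<Phi>] by blast
      then have "diag_grad \<Phi> y = 0" by (simp add: diag_grad_def vec_eq_iff)
      then show ?thesis using rpos by (simp add: H_def g_def defect_cost_def flux_def)
    qed
    have "compactly_supported H"
    proof -
      obtain R where "\<And>x. x \<in> cbox 0 (1::real^2) \<Longrightarrow> norm x \<le> R"
        using bounded_cbox[of 0 "1::real^2"] unfolding bounded_iff by blast
      then have "\<forall>x. R < norm x \<longrightarrow> H x = 0" using H0 by (meson not_le)
      then show ?thesis unfolding compactly_supported_def by blast
    qed
    then have iH: "integrable lborel H" by (rule integrable_compactly_supported[OF _ cH])
    have eq: "\<Lambda>' * \<bar>F x $ 1\<bar> powr r - \<bar>D 1 (w 1) x\<bar> powr r = H (x + p)" for x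
      by (simp add: H_def g_def defect_cost_def F_def diag_grad_def Dw)
    have "continuous_on UNIV (\<lambda>x. H (x + p))"
      by (intro continuous_on_compose2[OF cH] continuous_intros) auto
    then have "(LINT x|lebesgue_on ?B. H (x + p)) = (LINT x|lborel. H (x + p))"
      by (rule integral_lebesgue_on_eq_lborel[OF _ _ B(2)]) (use H0 box boxB in blast)
    also have "\<dots> = (LINT x|lborel. H x)" using iH by (intro lborel_integral_translate) auto
    also have "\<dots> = cost g 0 \<Phi>"
    proof (rule has_integral_unique)
      show "(H has_integral (LINT x|lborel. H x)) UNIV" by (rule has_integral_integral_lborel[OF iH])
      have "(H has_integral cost g 0 \<Phi>) (cbox 0 1)"
        unfolding cost_def H_def[symmetric]
        by (intro integrable_integral integrable_continuous continuous_on_subset[OF cH]) auto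
      then show "(H has_integral cost g 0 \<Phi>) UNIV"
        by (rule has_integral_on_superset) (use H0 in auto)
    qed
    finally show ?thesis by (simp add: eq)
  qed
  define I where "I = (LINT x|lebesgue_on ?B. \<bar>F x $ 1\<bar> powr r)"
  have cost_split: "\<Lambda>' * I - (LINT x|lebesgue_on ?B. \<bar>D 1 (w 1) x\<bar> powr r) = cost g 0 \<Phi>"
    unfolding cost_eq[symmetric] I_def
    by (subst Bochner_Integration.integral_diff) (auto intro!: intp cF1 cD)
  have lower: "(LINT x|lebesgue_on ?B. \<bar>D 1 (w 1) x\<bar> powr r) \<le> (LINT x|lebesgue_on ?B. norm (grad (w 1) x) powr r)"
  proof (rule integral_mono)
    show "integrable (lebesgue_on ?B) (\<lambda>x. \<bar>D 1 (w 1) x\<bar> powr r)" by (rule intp[OF cD])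
    show "integrable (lebesgue_on ?B) (\<lambda>x. norm (grad (w 1) x) powr r)"
      using intp[of "\<lambda>x. norm (grad (w 1) x)"] by (simp add: continuous_on_norm continuous_on_grad[OF sw])
    show "\<bar>D 1 (w 1) x\<bar> powr r \<le> norm (grad (w 1) x) powr r" for x
      using component_le_norm_cart[of "grad (w 1) x" 1] rpos by (intro powr_mono2) (auto simp: grad_nth)
  qed
  have upper: "(LINT x|lebesgue_on ?B. norm (F x) powr r) \<le> 2 powr r * I + c"
  proof -
    have "(LINT x|lebesgue_on ?B. norm (F x) powr r) \<le>
        (LINT x|lebesgue_on ?B. 2 powr r * \<bar>F x $ 1\<bar> powr r + 2 powr r * 3 powr r)"
    proof (rule integral_mono)
      show "integrable (lebesgue_on ?B) (\<lambda>x. norm (F x) powr r)"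
        using intp[of "\<lambda>x. norm (F x)"] cF by (simp add: continuous_on_norm)
      show "integrable (lebesgue_on ?B) (\<lambda>x. 2 powr r * \<bar>F x $ 1\<bar> powr r + 2 powr r * 3 powr r)"
        by (intro continuous_integrable_lebesgue_on B continuous_intros cp cF1)
      fix x
      \<comment> \<open>Here y stands for d2 u, which the transversal bound 1 controls; adding
        \<bar>d1 v\<bar> \<le> 1 gives the 3.\<close>
      have "\<bar>flux \<theta> y\<bar> \<le> 2" if "\<bar>y\<bar> \<le> 1" for y
      proof -
        have "sqrt \<theta> \<le> 1" using assms by simp
        then have "\<bar>sqrt \<theta> * sin (pi * y)\<bar> \<le> 1 * 1"
          unfolding abs_mult using assms by (intro mult_mono) auto
        then have "\<bar>1 + sqrt \<theta> * sin (pi * y)\<bar> * \<bar>y\<bar> \<le> 2 * 1" using that by (intro mult_mono) auto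
        then show ?thesis by (simp add: flux_def abs_mult)
      qed
      from this[of "D 2 (w 1) x"] have "\<bar>F x $ 2\<bar> \<le> 3"
        using off[of 2 1 "x + p"] off[of 1 2 "x + p"] by (simp add: F_def Dw)
      then have "norm (F x) \<le> \<bar>F x $ 1\<bar> + 3" using norm_le_l1_cart[of "F x"] by (simp add: sum_2)
      then have "norm (F x) powr r \<le> (\<bar>F x $ 1\<bar> + 3) powr r" using rpos by (intro powr_mono2) auto
      also have "\<dots> \<le> 2 powr r * \<bar>F x $ 1\<bar> powr r + 2 powr r * 3 powr r"
        by (rule powr_add_le) (use rpos in auto)
      finally show "norm (F x) powr r \<le> 2 powr r * \<bar>F x $ 1\<bar> powr r + 2 powr r * 3 powr r" .
    qed
    also have "\<dots> = 2 powr r * I + c"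
      unfolding I_def c_def
      by (subst Bochner_Integration.integral_add) (auto intro!: intp cF1 continuous_integrable_lebesgue_on B continuous_intros)
    finally show ?thesis .
  qed
  have "\<Lambda> * (LINT x|lebesgue_on ?B. norm (F x) powr r) \<le> \<Lambda> * (2 powr r * I + c)"
    using upper assms(3) by (intro mult_left_mono) auto
  then have "\<Lambda> * (1 + (LINT x|lebesgue_on ?B. norm (F x) powr r)) \<le> \<Lambda> + \<Lambda>' * I + \<Lambda> * c"
    by (simp add: \<Lambda>'_def algebra_simps)
  also have "\<dots> < (LINT x|lebesgue_on ?B. norm (grad (w 1) x) powr r)"
    using cost_split \<Phi>(2) lower by linarith
  finally have fin: "(LINT x|lebesgue_on ?B. norm (grad (w 1) x) powr r) >
     \<Lambda> * (1 + (LINT x|lebesgue_on ?B. norm (F x) powr r))" .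
  obtain C where C: "C-lipschitz_on (cball 0 1) (w 1)"
    using smooth_compactly_supported_lipschitz[OF sw W(2)] by blast
  show ?thesis
  proof (rule exI[of _ "w 1"], rule exI[of _ "grad (w 1)"], rule exI[of _ F], intro conjI ballI)
    show "\<exists>C. C-lipschitz_on (cball 0 1) (w 1)" using C by blast
    show "w 1 \<in> W1_infty_0 ?B" by (rule test_function_W1_infty_0[OF wt B])
    show "has_weak_gradient ?B (w 1) (grad (w 1))" by (rule smooth_has_weak_gradient[OF sw W(2) B(2)])
    show "F \<in> L_infty ?B" by (rule continuous_L_infty[OF cF B(1)])
    show "distr_div ?B (\<lambda>x. A_field \<theta> (grad (w 1) x)) \<phi> =
        distr_div ?B F \<phi>" if "\<phi> \<in> test_functions ?B" for \<phi>
      by (rule div[OF that])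
    show "w 1 x = 0" if "x \<in> sphere 0 1" for x
      by (rule W(3)) (use that in auto)
  qed (rule fin)
qed

end
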